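(* Fix an integer $n\geq 3$, and let $G$ be a connected simple graph on $n$ vertices. Let $f:\Omega\to\mathbb{C}$, where $\Omega$ is any of $\mathbb{R}$, $\mathbb{C}$, or $(0,\infty)$. (1) If $G$ is a tree, then the following are equivalent: (a) For every Hermitian matrix $A\in M_G(\Omega)$: $A$ is positive definite if and only if $f_G[A]$ is positive definite. (b) There exists a real $\alpha>0$ such that $f(x)=\alpha x$ for all $x\in\Omega\cap\mathbb{R}$, and $|f(z)|=\alpha|z|$ and $f(\overline{z})=\overline{f(z)}$ for all $z\in\Omega\setminus\mathbb{R}$. (2) If $G$ is not a tree, then the following are equivalent: (a) For every Hermitian matrix $A\in M_G(\Omega)$: $A$ is positive definite if and only if $f_G[A]$ is positive definite. (b) There exists a real $\alpha>0$ such that either $f(z)=\alpha z$ for all $z\in\Omega$, or $f(z)=\alpha\overline{z}$ for all $z\in\Omega$. The same holds if "positive definite" is replaced by "positive semidefinite" throughout.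
   Context: Let $G=(V,E)$ be a simple undirected graph on $V=\{1,\dots,n\}$. For $\Omega\subseteq\mathbb{C}$, $M_G(\Omega)$ is the set of $A=(a_{ij})\in M_n(\mathbb{C})$ such that $a_{ij}=0$ for all $i\neq j$ with $(i,j)\notin E$, and $a_{ij}\in\Omega$ otherwise (i.e., if $i=j$ or $(i,j)\in E$). For $f:\Omega\to\mathbb{C}$ and $A\in M_G(\Omega)$, $f_G[A]\in M_n(\mathbb{C})$ is the matrix with $(f_G[A])_{ij}=f(a_{ij})$ if $i=j$ or $(i,j)\in E$, and $(f_G[A])_{ij}=0$ otherwise. Positive (semi)definite matrices are Hermitian by definition. *)

theory Defs
  imports
    "Jordan_Normal_Form.Schur_Decomposition"
    "Graph_Theory.Graph_Theory"
begin

(* A simple undirected graph is a symmetric loop-free digraph (locale pair_graph): an edge {i,j}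
   is the pair of arcs (i,j), (j,i).  Under this encoding a single edge already is a directed
   cycle of length 2, so the library's tree and forest predicates do not describe undirected
   trees; hence the length bound. *)
definition has_undirected_cycle :: "'a pair_pre_digraph \<Rightarrow> bool" where
  "has_undirected_cycle G \<longleftrightarrow> (\<exists>p. pre_digraph.cycle (with_proj G) p \<and> 3 \<le> length p)"

definition undirected_tree :: "'a pair_pre_digraph \<Rightarrow> bool" where
  "undirected_tree G \<longleftrightarrow>
     Digraph_Component.connected (with_proj G) \<and> \<not> has_undirected_cycle G"

definition hermitian :: "complex mat \<Rightarrow> bool" where
  "hermitian A \<longleftrightarrow> mat_adjoint A = A"

(* The order on complex numbers is that of HOL-Library.Complex_Order:
   0 < z says that z is real and positive. *)
definition positive_definite :: "complex mat \<Rightarrow> bool" where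
  "positive_definite A \<longleftrightarrow> hermitian A \<and>
     (\<forall>v \<in> carrier_vec (dim_row A). v \<noteq> 0\<^sub>v (dim_row A) \<longrightarrow> 0 < (A *\<^sub>v v) \<bullet>c v)"

definition positive_semidefinite :: "complex mat \<Rightarrow> bool" where
  "positive_semidefinite A \<longleftrightarrow> hermitian A \<and>
     (\<forall>v \<in> carrier_vec (dim_row A). 0 \<le> (A *\<^sub>v v) \<bullet>c v)"

(* The set M_G(\<Omega>).  Matrix indices, and so the vertices, are 0,...,n-1. *)
definition graph_matrices :: "nat \<Rightarrow> nat pair_pre_digraph \<Rightarrow> complex set \<Rightarrow> complex mat set" where
  "graph_matrices n G \<Omega> = {A \<in> carrier_mat n n. \<forall>i<n. \<forall>j<n.
     (if i = j \<or> (i, j) \<in> parcs G then A $$ (i, j) \<in> \<Omega> else A $$ (i, j) = 0)}"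

(* The matrix f_G[A]. *)
definition graph_map ::
  "nat \<Rightarrow> nat pair_pre_digraph \<Rightarrow> (complex \<Rightarrow> complex) \<Rightarrow> complex mat \<Rightarrow> complex mat" where
  "graph_map n G f A = mat n n (\<lambda>(i, j).
     if i = j \<or> (i, j) \<in> parcs G then f (A $$ (i, j)) else 0)"

end

(* For x > 0 write f x = g x.  Matrices with one prominent edge and otherwise small or strongly
   dominated edges show that g is strictly increasing and that c^2 < a b is equivalent to
   g(c)^2 < g(a) g(b); hence g is continuous and g(1) g(c^2) = g(c)^2.  A path with three vertices
   then shows that g is additive, so that g(x) = alpha x.  The same one-edge matrices give
   f(cnj z) = cnj(f z) and |f z| = alpha |z| on the edges, and f(-x) = -alpha x on the diagonal.

   On a tree, phases of edge entries are removed by conjugation with a diagonal unitary matrix, so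
   nothing more can be said.  On a cycle, definiteness of a matrix with unit weights on a path and
   closing entry z is governed by |z cnj u + 1/m|, where u is the phase of the first edge.  So
   Re(z cnj u) is preserved; u = -1 and u = i force f z = alpha z or f z = alpha cnj z. *)

theory Submission
  imports Defs
begin

section \<open>Geometrically convex functions\<close>

text \<open>When \<Omega> is (0, infinity), no entry on an edge can be set to zero. So every test
  matrix carries some \<open>e > 0\<close> on the remaining edges, and its image carries
  \<open>g e\<close> there. A small \<open>e\<close> is harmless in the matrix itself, but
  \<open>g e\<close> cannot be called small until \<open>g\<close> is known to tend to 0 at 0. This
  obstacle fixes the logical order. Bounds that start from a definite matrix use small
  \<open>e\<close>. The converse bounds must use a fixed entry and outweigh its image by huge
  diagonal values, which requires \<open>g\<close> to be unbounded. Only the resulting relation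
  between g(c^2) and g(c)^2 yields decay at 0, after which small entries are available on both
  sides. The property studied is used only through its position between definite and semidefinite.
  Hence each comparison has a strict hypothesis and a weak conclusion, and continuity has to recover
  the boundary cases. The summand 1/m for cycles comes from a path of m unit edges: eliminating its
  interior couples the two ends with weight 1/m. Without it the criterion would see only
  |z|.\<close>

lemma isCont_geometrically_convex:
  fixes g :: "real \<Rightarrow> real"
  assumes mono: "\<And>x y. 0 < x \<Longrightarrow> x < y \<Longrightarrow> g x < g y"
    and pos: "\<And>x. 0 < x \<Longrightarrow> 0 < g x"
    and conv: "\<And>a b c. 0 < a \<Longrightarrow> 0 < b \<Longrightarrow> 0 < c \<Longrightarrow> c\<^sup>2 < a * b \<Longrightarrow> (g c)\<^sup>2 \<le> g a * g b"
    and u: "0 < u"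
  shows "isCont g u"
proof -
  define L where "L = Sup (g ` {0<..<u})"
  define R where "R = Inf (g ` {u<..})"
  have bdL: "bdd_above (g ` {0<..<u})" using mono u
    by (intro bdd_aboveI[of _ "g u"]) (auto intro: less_imp_le)
  have bdR: "bdd_below (g ` {u<..})" using mono u
    by (intro bdd_belowI[of _ "g u"]) (auto intro: less_imp_le)
  have neL: "g ` {0<..<u} \<noteq> {}" using u by auto
  have neR: "g ` {u<..} \<noteq> {}" by auto
  have L_upper: "g x \<le> L" if "0 < x" "x < u" for x
    unfolding L_def using that bdL by (intro cSup_upper) auto
  have R_lower: "R \<le> g x" if "u < x" for x
    unfolding R_def using that bdR by (intro cInf_lower) auto
  have guR: "g u \<le> R"
    unfolding R_def using neR mono u by (intro cInf_greatest) (auto intro: less_imp_le)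
  have Lgu: "L \<le> g u"
    unfolding L_def using neL mono u by (intro cSup_least) (auto intro: less_imp_le)
  have Rpos: "0 < R" using guR pos[OF u] by linarith
  have Lpos: "0 < L" using L_upper[of "u/2"] pos[of "u/2"] u by linarith
  \<comment> \<open>\<open>L\<close> and \<open>R\<close> are the one-sided limits at
    \<open>u\<close>. Since u s lies to the right of u and u / s to its left, R^2 \<le> g(u s)^2
    \<le> g(u / s) g(y) \<le> L g(y). The infimum over y gives R^2 \<le> L R, so there is no
    jump.\<close>
  have step: "R\<^sup>2 / L \<le> g y" if y: "u < y" for y
  proof -
    \<comment> \<open>The fourth root makes (u / s) y equal to (u s)^2 s; the factor s > 1 provides
      the strict inequality that \<open>conv\<close> asks for.\<close>
    define s where "s = sqrt (sqrt (y / u))"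
    have s1: "1 < s" unfolding s_def using y u by (simp add: field_simps)
    have "s ^ 4 = ((s\<^sup>2)\<^sup>2)" by (simp add: power2_eq_square eval_nat_numeral)
    then have s4: "s ^ 4 = y / u" unfolding s_def using y u by simp
    have us: "u < u * s" using u s1 by simp
    have "u / s < u" using u s1 by (simp add: field_simps)
    moreover have "0 < u / s" using u s1 by simp
    ultimately have 1: "g (u / s) \<le> L" "0 < u / s" using L_upper by auto
    have "(u * s)\<^sup>2 < u / s * y"
    proof -
      have "y = u * s ^ 4" using s4 u by (simp add: field_simps)
      then have "u / s * y = (u * s)\<^sup>2 * s"
        using s1 by (simp add: field_simps power2_eq_square eval_nat_numeral)
      moreover have "(u * s)\<^sup>2 > 0" using u s1 by simp
      ultimately show ?thesis using s1 by simp
    qed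
    then have "(g (u * s))\<^sup>2 \<le> g (u / s) * g y"
      using u s1 y by (intro conv) auto
    moreover have "R\<^sup>2 \<le> (g (u * s))\<^sup>2"
      using R_lower[OF us] Rpos by (intro power_mono) auto
    moreover have "g (u / s) * g y \<le> L * g y"
      using 1 pos[of y] y u by (intro mult_right_mono) auto
    ultimately have "R\<^sup>2 \<le> L * g y" by linarith
    then show ?thesis using Lpos by (simp add: field_simps)
  qed
  have "R\<^sup>2 / L \<le> R"
    unfolding R_def[symmetric] by (subst (2) R_def, rule cInf_greatest[OF neR]) (use step in auto)
  then have "R * R \<le> R * L" using Lpos by (simp add: field_simps power2_eq_square)
  then have RL: "R \<le> L" using Rpos by simp
  have "(g \<longlongrightarrow> g u) (nhds u)"
  proof (rule order_tendstoI)
    fix a assume "a < g u"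
    then have "a < L" using guR RL by linarith
    then obtain x where x: "0 < x" "x < u" "a < g x"
      unfolding L_def using less_cSup_iff[OF neL bdL] by auto
    have "a < g z" if "z > x" for z using mono[of x z] x that by linarith
    then show "\<forall>\<^sub>F z in nhds u. a < g z"
      using eventually_nhds_in_open[of "{x<..}" u] x
      by (auto elim!: eventually_mono)
  next
    fix a assume "g u < a"
    then have "R < a" using Lgu RL by linarith
    then obtain y where y: "u < y" "g y < a"
      unfolding R_def using cInf_less_iff[OF neR bdR] by auto
    have "g z < a" if "0 < z" "z < y" for z using mono[of z y] y that by linarith
    then show "\<forall>\<^sub>F z in nhds u. g z < a"
      using eventually_nhds_in_open[of "{0<..<y}" u] y u
      by (auto elim!: eventually_mono)
  qed
  then show ?thesis
    by (simp add: isCont_def tendsto_at_iff_tendsto_nhds)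
qed

lemma isCont_le_of_right:
  fixes g :: "real \<Rightarrow> real"
  assumes "isCont g c" and "\<And>x. c < x \<Longrightarrow> K \<le> g x"
  shows "K \<le> g c"
proof (rule tendsto_lowerbound)
  show "(g \<longlongrightarrow> g c) (at_right c)" using assms(1) by (auto simp: isCont_def intro: tendsto_mono[OF at_le])
  show "\<forall>\<^sub>F x in at_right c. K \<le> g x"
    using assms(2) by (intro eventually_at_rightI[of c "c + 1"]) auto
qed simp

lemma isCont_ge_of_left:
  fixes g :: "real \<Rightarrow> real"
  assumes "isCont g c" and "0 < c" and "\<And>x. 0 < x \<Longrightarrow> x < c \<Longrightarrow> g x \<le> K"
  shows "g c \<le> K"
proof (rule tendsto_upperbound)
  show "(g \<longlongrightarrow> g c) (at_left c)" using assms(1) by (auto simp: isCont_def intro: tendsto_mono[OF at_le])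
  show "\<forall>\<^sub>F x in at_left c. g x \<le> K"
    using assms(2,3) by (intro eventually_at_leftI[of 0 c]) auto
qed simp

text \<open>\<open>conc\<close>, read contrapositively at x > c, bounds g(1) g(c^2) by g(x)^2, and
  \<open>conv\<close> at x < c gives the opposite bound. Neither reaches x = c, so continuity closes
  the gap.\<close>

lemma mult_preserving_square:
  fixes g :: "real \<Rightarrow> real"
  assumes mono: "\<And>x y. 0 < x \<Longrightarrow> x < y \<Longrightarrow> g x < g y"
    and pos: "\<And>x. 0 < x \<Longrightarrow> 0 < g x"
    and conv: "\<And>a b c. 0 < a \<Longrightarrow> 0 < b \<Longrightarrow> 0 < c \<Longrightarrow> c\<^sup>2 < a * b \<Longrightarrow> (g c)\<^sup>2 \<le> g a * g b"
    and conc: "\<And>a b c. 0 < a \<Longrightarrow> 0 < b \<Longrightarrow> 0 < c \<Longrightarrow> (g c)\<^sup>2 < g a * g b \<Longrightarrow> c\<^sup>2 \<le> a * b"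
    and c: "0 < c"
  shows "g 1 * g (c\<^sup>2) = (g c)\<^sup>2"
proof (rule antisym)
  have cont: "isCont (\<lambda>x. (g x)\<^sup>2) c"
    using isCont_geometrically_convex[OF mono pos conv c] by (intro isCont_power)
  have c2: "0 < c\<^sup>2" using c by simp
  show "g 1 * g (c\<^sup>2) \<le> (g c)\<^sup>2"
  proof (rule isCont_le_of_right[OF cont])
    fix x assume "c < x"
    then have "c\<^sup>2 < x\<^sup>2" "0 < x" using c by (auto intro: power_strict_mono)
    then show "g 1 * g (c\<^sup>2) \<le> (g x)\<^sup>2" using conc[of 1 "c\<^sup>2" x] c2 by (smt (verit))
  qed
  show "(g c)\<^sup>2 \<le> g 1 * g (c\<^sup>2)"
  proof (rule isCont_ge_of_left[OF cont c])
    fix x assume "0 < x" "x < c"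
    then have "x\<^sup>2 < c\<^sup>2" "0 < x" by (auto intro: power_strict_mono)
    then show "(g x)\<^sup>2 \<le> g 1 * g (c\<^sup>2)" using conv[of 1 "c\<^sup>2" x] c2 by (smt (verit))
  qed
qed

text \<open>Repeated squaring from 1/2 multiplies \<open>g 1\<close> by r^(2^k), where r = g(1/2) /
  g(1) < 1 by strict monotonicity. Monotonicity and positivity alone would allow a positive limit at
  0.\<close>

lemma small_value_of_mult_square:
  fixes g :: "real \<Rightarrow> real"
  assumes mono: "\<And>x y. 0 < x \<Longrightarrow> x < y \<Longrightarrow> g x < g y"
    and pos: "\<And>x. 0 < x \<Longrightarrow> 0 < g x"
    and sq: "\<And>c. 0 < c \<Longrightarrow> g 1 * g (c\<^sup>2) = (g c)\<^sup>2"
    and e: "0 < e"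
  obtains d where "0 < d" "g d < e"
proof -
  define r where "r = g (1/2) / g 1"
  have r: "0 < r" "r < 1" unfolding r_def using pos[of 1] pos[of "1/2"] mono[of "1/2" 1] by auto
  have iter: "g ((1/2) ^ (2 ^ k)) = g 1 * r ^ (2 ^ k)" for k
  proof (induction k)
    case 0
    then show ?case unfolding r_def using pos[of 1] by simp
  next
    case (Suc k)
    have "g 1 * g ((1/2) ^ (2 ^ Suc k)) = (g ((1/2) ^ (2 ^ k)))\<^sup>2"
      using sq[of "(1/2) ^ (2 ^ k)"] by (simp add: power_mult[symmetric] mult.commute)
    also have "\<dots> = g 1 * (g 1 * r ^ (2 ^ Suc k))"
      unfolding Suc.IH by (simp add: power_mult_distrib power_mult[symmetric] mult.commute power2_eq_square)
        (simp add: mult_2 power_add algebra_simps)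
    finally show ?case using pos[of 1] by simp
  qed
  obtain k where k: "r ^ k < e / g 1"
    using real_arch_pow_inv[of "e / g 1" r] r e pos[of 1] by auto
  have "r ^ (2 ^ k) \<le> r ^ k"
    using r by (intro power_decreasing) (auto intro: less_imp_le less_exp)
  then have "g 1 * r ^ (2 ^ k) < e" using k pos[of 1] by (simp add: field_simps) (smt (verit) mult_left_mono)
  then show ?thesis using iter[of k] by (intro that[of "(1/2) ^ (2 ^ k)"]) auto
qed

text \<open>For k \<le> N x < k + 1, additivity and monotonicity trap N g(x) and g(1) N x in the
  same interval of length g(1). Thus N |g(x) - g(1) x| \<le> g(1) for every N.\<close>

lemma additive_mono_linear:
  fixes g :: "real \<Rightarrow> real"
  assumes mono: "\<And>x y. 0 < x \<Longrightarrow> x < y \<Longrightarrow> g x < g y"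
    and pos: "\<And>x. 0 < x \<Longrightarrow> 0 < g x"
    and add: "\<And>x y. 0 < x \<Longrightarrow> 0 < y \<Longrightarrow> g (x + y) = g x + g y"
    and x: "0 < x"
  shows "g x = g 1 * x"
proof -
  have mult: "g (real (Suc k) * y) = real (Suc k) * g y" if "0 < y" for k y
  proof (induction k)
    case (Suc k)
    have "g (real (Suc (Suc k)) * y) = g (real (Suc k) * y + y)" by (simp add: algebra_simps)
    also have "\<dots> = g (real (Suc k) * y) + g y"
      using that by (intro add) auto
    finally show ?case using Suc by (simp add: algebra_simps)
  qed simp
  have bound: "real (Suc n) * \<bar>g x - g 1 * x\<bar> \<le> g 1" for n
  proof -
    define N where "N = real (Suc n)"
    define k where "k = nat \<lfloor>N * x\<rfloor>"
    have Nx: "0 < N * x" using x by (simp add: N_def)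
    have k: "real k \<le> N * x" "N * x < real (Suc k)" unfolding k_def using Nx by linarith+
    have gN: "g (N * x) = N * g x" unfolding N_def using mult[OF x] .
    have "g 1 * real k \<le> g (N * x)"
    proof (cases k)
      case 0 then show ?thesis using pos[OF Nx] by simp
    next
      case (Suc j)
      then have "g (real k * 1) = real k * g 1" using mult[of 1 j] by simp
      then show ?thesis using mono[of "real k" "N * x"] k Suc by (cases "real k = N * x") (auto simp: mult.commute)
    qed
    moreover have "g (N * x) \<le> g 1 * real (Suc k)"
      using mult[of 1 k] mono[OF Nx k(2)] by (simp add: mult.commute)
    moreover have "g 1 * real k \<le> g 1 * (N * x)" "g 1 * (N * x) \<le> g 1 * real (Suc k)"
      using k pos[of 1] by (intro mult_left_mono; simp)+
    ultimately have "\<bar>N * g x - g 1 * (N * x)\<bar> \<le> g 1"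
      unfolding gN by (simp add: algebra_simps)
    moreover have "N * g x - g 1 * (N * x) = N * (g x - g 1 * x)" by (simp add: algebra_simps)
    ultimately show ?thesis by (simp add: abs_mult N_def)
  qed
  show ?thesis
  proof (rule ccontr)
    assume "g x \<noteq> g 1 * x"
    then have d: "0 < \<bar>g x - g 1 * x\<bar>" by simp
    obtain n where "g 1 < real n * \<bar>g x - g 1 * x\<bar>" using reals_Archimedean3[OF d] by blast
    moreover have "real n * \<bar>g x - g 1 * x\<bar> \<le> real (Suc n) * \<bar>g x - g 1 * x\<bar>" by (intro mult_right_mono) auto
    ultimately show False using bound[of n] by linarith
  qed
qed

text \<open>The error factor \<open>e\<close> is only asked to exist below each \<delta>, because in
  one application it is a value \<open>g d\<close>, reached through the choice of
  \<open>d\<close>.\<close>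

lemma small_multiple:
  fixes A B K :: real
  assumes "0 \<le> K" "\<And>\<delta>. 0 < \<delta> \<Longrightarrow> \<exists>e. e < \<delta> \<and> A \<le> B + e * K"
  shows "A \<le> B"
proof (rule ccontr)
  assume "\<not> A \<le> B"
  then have "0 < (A - B) / (K + 1)" using assms(1) by simp
  then obtain e where e: "e < (A - B) / (K + 1)" "A \<le> B + e * K" using assms(2) by blast
  have "e * K \<le> (A - B) / (K + 1) * K" using e assms(1) by (intro mult_right_mono) auto
  also have "\<dots> < (A - B) / (K + 1) * (K + 1)"
    using \<open>0 < (A - B) / (K + 1)\<close> by (intro mult_strict_left_mono) auto
  also have "\<dots> = A - B" using assms(1) by simp
  finally show False using e by simp
qed

section \<open>Hermitian forms\<close>

text \<open>The form v^* A v with the real part taken term by term, so that it is real by type; for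
  a Hermitian matrix it is the full form. Vectors are functions of which only the first
  \<open>n\<close> values count.\<close>

definition qform :: "nat \<Rightarrow> (nat \<Rightarrow> nat \<Rightarrow> complex) \<Rightarrow> (nat \<Rightarrow> complex) \<Rightarrow> real" where
  "qform n a v = (\<Sum>i<n. \<Sum>j<n. Re (cnj (v i) * a i j * v j))"

definition herm_on :: "nat \<Rightarrow> (nat \<Rightarrow> nat \<Rightarrow> complex) \<Rightarrow> bool" where
  "herm_on n a \<longleftrightarrow> (\<forall>i<n. \<forall>j<n. a j i = cnj (a i j))"

definition pd_on :: "nat \<Rightarrow> (nat \<Rightarrow> nat \<Rightarrow> complex) \<Rightarrow> bool" where
  "pd_on n a \<longleftrightarrow> herm_on n a \<and> (\<forall>v. (\<exists>i<n. v i \<noteq> 0) \<longrightarrow> 0 < qform n a v)"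

definition psd_on :: "nat \<Rightarrow> (nat \<Rightarrow> nat \<Rightarrow> complex) \<Rightarrow> bool" where
  "psd_on n a \<longleftrightarrow> herm_on n a \<and> (\<forall>v. 0 \<le> qform n a v)"

lemma herm_onD: "herm_on n a \<Longrightarrow> i < n \<Longrightarrow> j < n \<Longrightarrow> a j i = cnj (a i j)"
  unfolding herm_on_def by blast

lemma herm_on_diag: "herm_on n a \<Longrightarrow> i < n \<Longrightarrow> a i i = complex_of_real (Re (a i i))"
  using arg_cong[OF herm_onD[of n a i i], of Im] by (simp add: complex_eq_iff)

lemma pd_on_imp_psd_on: "pd_on n a \<Longrightarrow> psd_on n a"
proof -
  assume a: "pd_on n a"
  have "0 \<le> qform n a v" for v
  proof (cases "\<exists>i<n. v i \<noteq> 0")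
    case True
    then show ?thesis using a by (auto simp: pd_on_def intro: less_imp_le)
  next
    case False
    then show ?thesis by (simp add: qform_def)
  qed
  then show ?thesis using a by (simp add: pd_on_def psd_on_def)
qed

text \<open>Each off-diagonal entry is split between its two diagonal entries by the arithmetic-geometric
  mean inequality with weights \<open>s i j\<close> and \<open>s j i\<close>.\<close>

lemma pd_on_of_weights:
  assumes herm: "herm_on n a"
    and nonneg: "\<And>i j. i < n \<Longrightarrow> j < n \<Longrightarrow> 0 \<le> s i j"
    and bound: "\<And>i j. i < n \<Longrightarrow> j < n \<Longrightarrow> i \<noteq> j \<Longrightarrow> (cmod (a i j))\<^sup>2 \<le> s i j * s j i"
    and dom: "\<And>i. i < n \<Longrightarrow> (\<Sum>j<n. s i j) < Re (a i i)"
  shows "pd_on n a"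
  unfolding pd_on_def
proof (intro conjI allI impI herm)
  fix v :: "nat \<Rightarrow> complex"
  assume "\<exists>i<n. v i \<noteq> 0"
  then obtain k where k: "k < n" "v k \<noteq> 0" by auto
  define m where "m i = (cmod (v i))\<^sup>2" for i
  have entry: "(if i = j then Re (a i i) * m i else 0) - (s i j * m i + s j i * m j) / 2
      \<le> Re (cnj (v i) * a i j * v j)" if ij: "i < n" "j < n" for i j
  proof (cases "i = j")
    case True
    have "Re (cnj (v i) * of_real (Re (a i i)) * v i) = Re (a i i) * m i"
      unfolding m_def cmod_power2 by (simp add: algebra_simps power2_eq_square)
    then have eq: "Re (cnj (v i) * a i i * v i) = Re (a i i) * m i"
      using herm_on_diag[OF herm ij(1)] by simp
    have "0 \<le> s i i * m i" using nonneg ij by (simp add: m_def)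
    then have "Re (a i i) * m i - (s i i * m i + s i i * m i) / 2 \<le> Re (cnj (v i) * a i i * v i)"
      unfolding eq by (simp add: mult.commute)
    then show ?thesis using True by simp
  next
    case False
    let ?x = "sqrt (s i j) * cmod (v i)" and ?y = "sqrt (s j i) * cmod (v j)"
    have "cmod (a i j) \<le> sqrt (s i j) * sqrt (s j i)"
      using bound[OF ij False] by (simp add: real_sqrt_mult[symmetric] real_le_rsqrt)
    then have "cmod (a i j) * (cmod (v i) * cmod (v j)) \<le> sqrt (s i j) * sqrt (s j i) * (cmod (v i) * cmod (v j))"
      by (intro mult_right_mono) auto
    also have "\<dots> = ?x * ?y" by simp
    also have "\<dots> \<le> (?x\<^sup>2 + ?y\<^sup>2) / 2" using sum_squares_bound[of ?x ?y] by simp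
    also have "\<dots> = (s i j * m i + s j i * m j) / 2"
      using nonneg ij by (simp add: m_def power_mult_distrib)
    finally have "cmod (cnj (v i) * a i j * v j) \<le> (s i j * m i + s j i * m j) / 2"
      by (simp add: norm_mult mult_ac)
    moreover have "- cmod (cnj (v i) * a i j * v j) \<le> Re (cnj (v i) * a i j * v j)"
      using abs_Re_le_cmod[of "cnj (v i) * a i j * v j"] by linarith
    ultimately have "- ((s i j * m i + s j i * m j) / 2) \<le> Re (cnj (v i) * a i j * v j)"
      by (meson neg_le_iff_le order.trans)
    then show ?thesis using False by simp
  qed
  have "(\<Sum>i<n. (Re (a i i) - (\<Sum>j<n. s i j)) * m i)
      = (\<Sum>i<n. \<Sum>j<n. (if i = j then Re (a i i) * m i else 0) - (s i j * m i + s j i * m j) / 2)"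
  proof -
    \<comment> \<open>Exchanging i and j moves the half charged to the second index onto the first,
      so each vertex pays exactly its row sum of \<open>s\<close>.\<close>
    have sw: "(\<Sum>i<n. \<Sum>j<n. s j i * m j) = (\<Sum>i<n. \<Sum>j<n. s i j * m i)"
      by (rule sum.swap)
    have "(\<Sum>i<n. \<Sum>j<n. (s i j * m i + s j i * m j) / 2) = (\<Sum>i<n. \<Sum>j<n. s i j * m i)"
      by (simp add: sum_divide_distrib[symmetric] sum.distrib sw)
    then show ?thesis
      by (simp add: sum_subtractf left_diff_distrib sum_distrib_right)
  qed
  also have "\<dots> \<le> qform n a v"
    unfolding qform_def by (intro sum_mono entry) auto
  finally have "(\<Sum>i<n. (Re (a i i) - (\<Sum>j<n. s i j)) * m i) \<le> qform n a v" .
  moreover have "0 < (\<Sum>i<n. (Re (a i i) - (\<Sum>j<n. s i j)) * m i)"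
  proof (rule sum_pos2[of _ k])
    show "0 < (Re (a k k) - (\<Sum>j<n. s k j)) * m k" using dom[of k] k by (simp add: m_def)
    show "0 \<le> (Re (a i i) - (\<Sum>j<n. s i j)) * m i" if "i \<in> {..<n}" for i
      using dom[of i] that by (intro mult_nonneg_nonneg) (auto simp: m_def)
  qed (use k in auto)
  ultimately show "0 < qform n a v" by linarith
qed

text \<open>Finitely many strict row inequalities leave room to add one \<epsilon> to every weight,
  and an entry of modulus at most \<epsilon> is then covered by \<epsilon> * \<epsilon>. As
  \<epsilon> depends on \<open>s\<close> and \<open>d\<close> alone, it serves all matrices with
  these bounds.\<close>

lemma pd_on_of_weights_slack:
  assumes nonneg: "\<And>i j. 0 \<le> s i j"
    and dom: "\<And>i. i < n \<Longrightarrow> (\<Sum>j<n. s i j) < d i"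
  obtains \<epsilon> :: real where "0 < \<epsilon>"
    and "\<And>a. herm_on n a \<Longrightarrow> (\<And>i. i < n \<Longrightarrow> d i \<le> Re (a i i)) \<Longrightarrow>
      (\<And>i j. i < n \<Longrightarrow> j < n \<Longrightarrow> i \<noteq> j \<Longrightarrow> (cmod (a i j))\<^sup>2 \<le> s i j * s j i \<or> cmod (a i j) \<le> \<epsilon>) \<Longrightarrow>
      pd_on n a"
proof -
  have "\<forall>\<^sub>F \<epsilon> in at_right 0. \<forall>i\<in>{..<n}. (\<Sum>j<n. s i j + \<epsilon>) < d i"
  proof (rule eventually_ball_finite)
    show "\<forall>i\<in>{..<n}. \<forall>\<^sub>F \<epsilon> in at_right 0. (\<Sum>j<n. s i j + \<epsilon>) < d i"
    proof
      fix i assume "i \<in> {..<n}"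
      moreover have "((\<lambda>\<epsilon>. \<Sum>j<n. s i j + \<epsilon>) \<longlongrightarrow> (\<Sum>j<n. s i j + 0)) (at_right 0)"
        by (intro tendsto_intros)
      ultimately show "\<forall>\<^sub>F \<epsilon> in at_right 0. (\<Sum>j<n. s i j + \<epsilon>) < d i"
        using dom by (intro order_tendstoD(2)) auto
    qed
  qed simp
  moreover have "\<forall>\<^sub>F \<epsilon> in at_right 0. (0::real) < \<epsilon>" by (rule eventually_at_right_less)
  ultimately have "\<forall>\<^sub>F \<epsilon> in at_right 0. 0 < \<epsilon> \<and> (\<forall>i\<in>{..<n}. (\<Sum>j<n. s i j + \<epsilon>) < d i)"
    by eventually_elim auto
  then obtain \<epsilon> where e: "0 < \<epsilon>" "\<And>i. i < n \<Longrightarrow> (\<Sum>j<n. s i j + \<epsilon>) < d i"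
    using eventually_happens'[OF trivial_limit_at_right_real] by blast
  show thesis
  proof (rule that[OF e(1)])
    fix a
    assume a: "herm_on n a" "\<And>i. i < n \<Longrightarrow> d i \<le> Re (a i i)"
      "\<And>i j. i < n \<Longrightarrow> j < n \<Longrightarrow> i \<noteq> j \<Longrightarrow> (cmod (a i j))\<^sup>2 \<le> s i j * s j i \<or> cmod (a i j) \<le> \<epsilon>"
    show "pd_on n a"
    proof (rule pd_on_of_weights[of n a "\<lambda>i j. s i j + \<epsilon>"])
      show "0 \<le> s i j + \<epsilon>" for i j using nonneg[of i j] e(1) by linarith
      show "(\<Sum>j<n. s i j + \<epsilon>) < Re (a i i)" if "i < n" for i
        using e(2) a(2) that by (meson less_le_trans)
      show "(cmod (a i j))\<^sup>2 \<le> (s i j + \<epsilon>) * (s j i + \<epsilon>)" if ij: "i < n" "j < n" "i \<noteq> j" for i j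
        using a(3)[OF ij]
      proof
        assume "(cmod (a i j))\<^sup>2 \<le> s i j * s j i"
        also have "\<dots> \<le> (s i j + \<epsilon>) * (s j i + \<epsilon>)"
          using nonneg e(1) by (intro mult_mono) (auto simp: add_nonneg_nonneg less_imp_le)
        finally show ?thesis .
      next
        assume "cmod (a i j) \<le> \<epsilon>"
        then have "(cmod (a i j))\<^sup>2 \<le> \<epsilon> * \<epsilon>" unfolding power2_eq_square by (intro mult_mono) (use e(1) in auto)
        also have "\<dots> \<le> (s i j + \<epsilon>) * (s j i + \<epsilon>)"
          using nonneg e(1) by (intro mult_mono) (auto simp: add_nonneg_nonneg less_imp_le)
        finally show ?thesis .
      qed
    qed (fact a(1))
  qed
qed

section \<open>Necessary conditions from test vectors with small support\<close>

lemma qform_support: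
  assumes "S \<subseteq> {..<n}" and "\<And>i. i \<notin> S \<Longrightarrow> v i = 0"
  shows "qform n a v = (\<Sum>i\<in>S. \<Sum>j\<in>S. Re (cnj (v i) * a i j * v j))"
proof -
  have "qform n a v = (\<Sum>i\<in>S. \<Sum>j<n. Re (cnj (v i) * a i j * v j))"
    unfolding qform_def using assms by (intro sum.mono_neutral_right) auto
  also have "\<dots> = (\<Sum>i\<in>S. \<Sum>j\<in>S. Re (cnj (v i) * a i j * v j))"
    using assms by (intro sum.cong sum.mono_neutral_right) auto
  finally show ?thesis .
qed

lemma psd_on_diag:
  assumes "psd_on n a" "p < n"
  shows "0 \<le> Re (a p p)"
proof -
  have "qform n a (\<lambda>i. if i = p then 1 else 0) = Re (a p p)"
    using assms(2) by (subst qform_support[of "{p}"]) auto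
  then show ?thesis using assms(1) unfolding psd_on_def by metis
qed

text \<open>With -z in coordinate p and t in coordinate q the form is A |z|^2 + B t^2 - 2 t |z|^2,
  smallest at t = |z|^2 / B. For B = 0 it is affine in t, which forces z = 0.\<close>

lemma psd_on_minor:
  assumes a: "psd_on n a" and pq: "p < n" "q < n" "p \<noteq> q"
  shows "(cmod (a p q))\<^sup>2 \<le> Re (a p p) * Re (a q q)"
proof -
  define z where "z = a p q"
  define A where "A = Re (a p p)"
  define B where "B = Re (a q q)"
  have h: "herm_on n a" using a by (simp add: psd_on_def)
  have ent: "a p q = z" "a q p = cnj z" "a p p = of_real A" "a q q = of_real B"
    using herm_onD[OF h pq(1,2)] herm_on_diag[OF h] pq by (simp_all add: z_def A_def B_def)
  have A: "0 \<le> A" and B: "0 \<le> B" using psd_on_diag[OF a] pq by (auto simp: A_def B_def)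
  have key: "2 * t * (cmod z)\<^sup>2 \<le> A * (cmod z)\<^sup>2 + B * t\<^sup>2" for t :: real
  proof -
    let ?v = "\<lambda>i. if i = p then - z else if i = q then of_real t else 0"
    have "qform n a ?v = A * (cmod z)\<^sup>2 + B * t\<^sup>2 - 2 * t * (cmod z)\<^sup>2"
      unfolding cmod_power2 using pq
      by (subst qform_support[of "{p, q}"]) (auto simp: ent algebra_simps power2_eq_square)
    moreover have "0 \<le> qform n a ?v" using a unfolding psd_on_def by blast
    ultimately show ?thesis by linarith
  qed
  have "(cmod z)\<^sup>2 \<le> A * B"
  proof (cases "B = 0 \<or> z = 0")
    case True
    have "z = 0" if "B = 0"
    proof -
      have "2 * (cmod z)\<^sup>2 \<le> 0"
        using key[of "A / 2 + 1"] that by (simp add: distrib_right)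
      then show ?thesis by simp
    qed
    then show ?thesis using True A B by auto
  next
    case False
    then have z: "0 < (cmod z)\<^sup>2" and b: "0 < B" using B by auto
    have "2 * ((cmod z)\<^sup>2 / B) * (cmod z)\<^sup>2
        \<le> (A + (cmod z)\<^sup>2 / B) * (cmod z)\<^sup>2"
      using key[of "(cmod z)\<^sup>2 / B"] b by (simp add: field_simps power2_eq_square)
    then have "2 * ((cmod z)\<^sup>2 / B) \<le> A + (cmod z)\<^sup>2 / B"
      using z by (metis mult_le_cancel_right_pos)
    then show ?thesis using b by (simp add: field_simps)
  qed
  then show ?thesis by (simp add: z_def A_def B_def)
qed

text \<open>For e = 0 the test vector (-x/m, 1, -y/m) minimises the form over its end coordinates
  and leaves the Schur complement of the middle entry. The last term is the error caused by an entry
  between the two ends.\<close>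

lemma psd_on_path:
  assumes a: "psd_on n a" and pqr: "p < n" "q < n" "r < n" "p \<noteq> q" "q \<noteq> r" "p \<noteq> r"
    and ent: "a p p = of_real m" "a r r = of_real m" "a q q = of_real b"
      "a p q = of_real x" "a q r = of_real y" "a p r = of_real e" and m: "0 < m"
  shows "0 \<le> b - (x\<^sup>2 + y\<^sup>2) / m + 2 * e * x * y / m\<^sup>2"
proof -
  have h: "herm_on n a" using a by (simp add: psd_on_def)
  have ent': "a q p = of_real x" "a r q = of_real y" "a r p = of_real e"
    using herm_onD[OF h pqr(1,2)] herm_onD[OF h pqr(2,3)] herm_onD[OF h pqr(1,3)] by (simp_all add: ent)
  define s t where "s = x / m" and "t = y / m"
  define v where "v i = complex_of_real (if i = p then - s else if i = q then 1 else if i = r then - t else 0)" for i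
  have ne: "q \<noteq> p" "r \<noteq> q" "r \<noteq> p" using pqr by auto
  have v: "v p = of_real (- s)" "v q = 1" "v r = of_real (- t)"
    using ne pqr by (simp_all add: v_def)
  have xy: "x = m * s" "y = m * t" using m by (simp_all add: s_def t_def)
  have "qform n a v = (\<Sum>i\<in>{p, q, r}. \<Sum>j\<in>{p, q, r}. Re (cnj (v i) * a i j * v j))"
    using pqr by (intro qform_support) (auto simp: v_def)
  also have "\<dots> = b - m * s\<^sup>2 - m * t\<^sup>2 + 2 * e * s * t"
    by (simp add: pqr ne v ent ent' xy) (simp add: algebra_simps power2_eq_square)
  also have "m * s\<^sup>2 = x\<^sup>2 / m"
    unfolding xy using m by (simp add: power2_eq_square)
  also have "m * t\<^sup>2 = y\<^sup>2 / m"
    unfolding xy using m by (simp add: power2_eq_square)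
  also have "2 * e * s * t = 2 * e * x * y / m\<^sup>2"
    unfolding xy using m by (simp add: power2_eq_square)
  finally have "qform n a v = b - (x\<^sup>2 + y\<^sup>2) / m + 2 * e * x * y / m\<^sup>2"
    by (simp add: add_divide_distrib)
  then show ?thesis using a unfolding psd_on_def by metis
qed

section \<open>Passage between functions of two indices and complex matrices\<close>

abbreviation mat_of_fun :: "nat \<Rightarrow> (nat \<Rightarrow> nat \<Rightarrow> complex) \<Rightarrow> complex mat" where
  "mat_of_fun n a \<equiv> mat n n (\<lambda>(i, j). a i j)"

lemma hermitian_mat_of_fun: "hermitian (mat_of_fun n a) \<longleftrightarrow> herm_on n a"
proof -
  have dim: "dim_row (mat_adjoint (mat_of_fun n a)) = n" "dim_col (mat_adjoint (mat_of_fun n a)) = n"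
    by (simp_all add: mat_adjoint_def)
  have entry: "mat_adjoint (mat_of_fun n a) $$ (i, j) = cnj (a j i)" if "i < n" "j < n" for i j
    using that by (simp add: mat_adjoint_def mat_of_rows_def)
  have "hermitian (mat_of_fun n a) \<longleftrightarrow> (\<forall>i<n. \<forall>j<n. cnj (a j i) = a i j)"
    unfolding hermitian_def mat_eq_iff by (simp add: dim entry)
  also have "\<dots> \<longleftrightarrow> herm_on n a"
    unfolding herm_on_def by metis
  finally show ?thesis .
qed

text \<open>For a Hermitian matrix, conjugating the double sum amounts to exchanging its indices. So
  the sum is real and agrees with its real part.\<close>

lemma mult_mat_cscalar_prod:
  assumes "herm_on n a"
  shows "(mat_of_fun n a *\<^sub>v vec n v) \<bullet>c vec n v = complex_of_real (qform n a v)"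
proof -
  let ?z = "(\<Sum>i<n. \<Sum>j<n. cnj (v i) * a i j * v j)"
  have row: "(mat_of_fun n a *\<^sub>v vec n v) $ i * conjugate (vec n v) $ i = (\<Sum>j<n. cnj (v i) * a i j * v j)"
    if "i < n" for i
  proof -
    have "(mat_of_fun n a *\<^sub>v vec n v) $ i = (\<Sum>j<n. a i j * v j)"
      using that by (simp add: scalar_prod_def lessThan_atLeast0)
    moreover have "conjugate (vec n v) $ i = cnj (v i)"
      using that by simp
    ultimately show ?thesis
      by (simp only: sum_distrib_right) (simp only: mult_ac)
  qed
  have "(mat_of_fun n a *\<^sub>v vec n v) \<bullet>c vec n v
      = (\<Sum>i<n. (mat_of_fun n a *\<^sub>v vec n v) $ i * conjugate (vec n v) $ i)"
    unfolding scalar_prod_def by (simp only: lessThan_atLeast0 dim_vec_conjugate dim_vec)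
  also have "\<dots> = ?z"
    by (intro sum.cong row) auto
  finally have eq: "(mat_of_fun n a *\<^sub>v vec n v) \<bullet>c vec n v = ?z" .
  have "cnj ?z = (\<Sum>i<n. \<Sum>j<n. cnj (v j) * a j i * v i)"
    unfolding cnj_sum
  proof (intro sum.cong refl)
    fix i j assume "i \<in> {..<n}" "j \<in> {..<n}"
    then have "cnj (a i j) = a j i" using herm_onD[OF assms, of i j] by simp
    then show "cnj (cnj (v i) * a i j * v j) = cnj (v j) * a j i * v i"
      by (simp only: complex_cnj_mult complex_cnj_cnj mult_ac)
  qed
  also have "\<dots> = ?z" by (rule sum.swap)
  finally have "cnj ?z = ?z" .
  then have "Im ?z = 0" using Reals_cnj_iff complex_is_Real_iff by blast
  moreover have "Re ?z = qform n a v" by (simp add: qform_def)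
  ultimately have "?z = complex_of_real (qform n a v)" by (simp only: complex_eq_iff Re_complex_of_real Im_complex_of_real)
  with eq show ?thesis by (simp only:)
qed

lemma all_carrier_vec_conv:
  fixes Q :: "'a vec \<Rightarrow> bool"
  shows "(\<forall>v \<in> carrier_vec n. Q v) \<longleftrightarrow> (\<forall>v. Q (vec n v))"
proof
  assume r: "\<forall>v. Q (vec n v)"
  show "\<forall>v \<in> carrier_vec n. Q v"
  proof
    fix v :: "'a vec" assume v: "v \<in> carrier_vec n"
    have "vec n (\<lambda>i. v $ i) = v" using v by auto
    then show "Q v" using r by metis
  qed
qed auto

lemma positive_definite_mat_of_fun: "positive_definite (mat_of_fun n a) \<longleftrightarrow> pd_on n a"
proof -
  have nz: "vec n v \<noteq> 0\<^sub>v n \<longleftrightarrow> (\<exists>i<n. v i \<noteq> 0)" for v :: "nat \<Rightarrow> complex"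
    unfolding vec_eq_iff by auto
  show ?thesis
  proof (cases "herm_on n a")
    case True
    have "(0 < (mat_of_fun n a *\<^sub>v vec n v) \<bullet>c vec n v) \<longleftrightarrow> 0 < qform n a v" for v
      unfolding mult_mat_cscalar_prod[OF True] less_complex_def by simp
    then show ?thesis
      unfolding positive_definite_def pd_on_def hermitian_mat_of_fun dim_row_mat all_carrier_vec_conv nz
      by blast
  qed (simp add: positive_definite_def pd_on_def hermitian_mat_of_fun)
qed

lemma positive_semidefinite_mat_of_fun: "positive_semidefinite (mat_of_fun n a) \<longleftrightarrow> psd_on n a"
proof (cases "herm_on n a")
  case True
  have "(0 \<le> (mat_of_fun n a *\<^sub>v vec n v) \<bullet>c vec n v) \<longleftrightarrow> 0 \<le> qform n a v" for v
    unfolding mult_mat_cscalar_prod[OF True] less_eq_complex_def by simp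
  then show ?thesis
    unfolding positive_semidefinite_def psd_on_def hermitian_mat_of_fun dim_row_mat all_carrier_vec_conv
    by blast
qed (simp add: positive_semidefinite_def psd_on_def hermitian_mat_of_fun)

section \<open>Test matrices\<close>

text \<open>Test matrices are written on all pairs of indices and cut down to the edges afterwards,
  so that one formula serves every graph. Cutting never increases a modulus, hence upper bounds
  survive it.\<close>

definition restr :: "(nat \<Rightarrow> nat \<Rightarrow> bool) \<Rightarrow> (nat \<Rightarrow> nat \<Rightarrow> complex) \<Rightarrow> nat \<Rightarrow> nat \<Rightarrow> complex" where
  "restr E a i j = (if i = j \<or> E i j then a i j else 0)"

lemma restr_diag [simp]: "restr E a i i = a i i"
  by (simp add: restr_def)

lemma restr_edge: "E i j \<Longrightarrow> restr E a i j = a i j"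
  by (simp add: restr_def)

lemma cmod_restr_le: "cmod (restr E a i j) \<le> cmod (a i j)"
  by (simp add: restr_def)

lemma herm_on_restr:
  assumes "herm_on n a" and "symp E"
  shows "herm_on n (restr E a)"
  unfolding herm_on_def restr_def
  using sympD[OF assms(2)] herm_onD[OF assms(1)] by (metis complex_cnj_zero)

text \<open>All off-diagonal positions except those of the pair {p, q} carry \<open>e\<close>, which
  must stay positive when 0 is missing from \<Omega>. It is made harmless either by its smallness or
  by a large \<open>D\<close>.\<close>

definition edge_test :: "nat \<Rightarrow> nat \<Rightarrow> real \<Rightarrow> real \<Rightarrow> complex \<Rightarrow> real \<Rightarrow> real \<Rightarrow> nat \<Rightarrow> nat \<Rightarrow> complex" where
  "edge_test p q a b z D e i j =
    (if i = j then of_real (if i = p then a else if i = q then b else D)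
     else if i = p \<and> j = q then z else if i = q \<and> j = p then cnj z else of_real e)"

lemma herm_on_edge_test: "herm_on n (edge_test p q a b z D e)"
  by (simp add: herm_on_def edge_test_def)

lemma edge_test_entries:
  assumes "p \<noteq> q"
  shows "edge_test p q a b z D e p p = of_real a" "edge_test p q a b z D e q q = of_real b"
    "edge_test p q a b z D e p q = z"
  using assms by (simp_all add: edge_test_def)

text \<open>Supplies weights for the prominent entry: their product is its squared modulus, and each
  stays strictly below its diagonal entry.\<close>

lemma sqrt_ratio_less_1:
  fixes a b z :: real
  assumes "0 < a" "0 < b" "z < a * b" "0 \<le> z"
  obtains k where "0 \<le> k" "k < 1" "k * a * (k * b) = z"
proof -
  define k where "k = sqrt (z / (a * b))"
  have ab: "0 < a * b" using assms by simp
  have k: "0 \<le> k" unfolding k_def using ab assms by simp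
  have "z / (a * b) < 1" using ab assms by simp
  then have "k < 1" by (simp add: k_def)
  moreover have "k\<^sup>2 = z / (a * b)" unfolding k_def using ab assms by simp
  then have "k * a * (k * b) = z" using assms by (auto simp: field_simps power2_eq_square)
  ultimately show thesis using that k by blast
qed

text \<open>The weights live on the pair {p, q} alone; every other off-diagonal entry is absorbed by
  the slack.\<close>

lemma pd_on_edge_test_small:
  assumes E: "symp E"
    and pq: "p < n" "q < n" "p \<noteq> q" and ab: "0 < a" "0 < b" "(cmod z)\<^sup>2 < a * b" and D: "0 < D"
  obtains \<epsilon> where "0 < \<epsilon>" "\<And>e. 0 \<le> e \<Longrightarrow> e \<le> \<epsilon> \<Longrightarrow> pd_on n (restr E (edge_test p q a b z D e))"
proof -
  obtain k where k: "0 \<le> k" "k < 1" "k * a * (k * b) = (cmod z)\<^sup>2"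
    using sqrt_ratio_less_1[OF ab] by auto
  define s where "s i j = (if i = p then if j = q then k * a else 0
    else if i = q then if j = p then k * b else 0 else 0)" for i j
  define d where "d i = (if i = p then a else if i = q then b else D)" for i
  have s: "0 \<le> s i j" for i j using k ab by (simp add: s_def)
  have dom: "(\<Sum>j<n. s i j) < d i" if "i < n" for i
    using pq k ab D by (simp add: s_def d_def)
  obtain \<epsilon> where e: "0 < \<epsilon>"
    "\<And>a. herm_on n a \<Longrightarrow> (\<And>i. i < n \<Longrightarrow> d i \<le> Re (a i i)) \<Longrightarrow>
      (\<And>i j. i < n \<Longrightarrow> j < n \<Longrightarrow> i \<noteq> j \<Longrightarrow> (cmod (a i j))\<^sup>2 \<le> s i j * s j i \<or> cmod (a i j) \<le> \<epsilon>) \<Longrightarrow>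
      pd_on n a"
    using pd_on_of_weights_slack[of s n d, OF s dom] by blast
  show thesis
  proof (rule that[OF e(1)])
    fix x :: real assume x: "0 \<le> x" "x \<le> \<epsilon>"
    let ?t = "edge_test p q a b z D x"
    show "pd_on n (restr E ?t)"
    proof (rule e(2))
      show "herm_on n (restr E ?t)" using herm_on_restr[OF herm_on_edge_test E] .
      show "d i \<le> Re (restr E ?t i i)" for i by (simp add: edge_test_def d_def)
      fix i j :: nat assume ij: "i \<noteq> j"
      show "(cmod (restr E ?t i j))\<^sup>2 \<le> s i j * s j i \<or> cmod (restr E ?t i j) \<le> \<epsilon>"
      proof (cases "(i = p \<and> j = q) \<or> (i = q \<and> j = p)")
        case True
        then have "cmod (?t i j) = cmod z" using ij by (auto simp: edge_test_def)
        then have "(cmod (restr E ?t i j))\<^sup>2 \<le> (cmod z)\<^sup>2"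
          using cmod_restr_le[of E ?t i j] by (intro power_mono) auto
        also have "\<dots> = s i j * s j i"
          using True pq k(3) by (auto simp: s_def mult_ac)
        finally show ?thesis by simp
      next
        case False
        then have "cmod (?t i j) \<le> \<epsilon>" using ij x by (auto simp: edge_test_def)
        then show ?thesis using cmod_restr_le[of E ?t i j] by linarith
      qed
    qed
  qed
qed

lemma pd_on_edge_test_exists:
  assumes "symp E"
    and "p < n" "q < n" "p \<noteq> q" "0 < a" "0 < b" "(cmod z)\<^sup>2 < a * b" "0 < D"
  obtains e where "0 < e" "pd_on n (restr E (edge_test p q a b z D e))"
proof -
  obtain \<epsilon> where "0 < \<epsilon>" "\<And>e. 0 \<le> e \<Longrightarrow> e \<le> \<epsilon> \<Longrightarrow> pd_on n (restr E (edge_test p q a b z D e))"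
    using pd_on_edge_test_small[of E p n q a b z D, OF assms] by blast
  then show thesis by (intro that[of \<epsilon>]) auto
qed

text \<open>Here \<open>e\<close> has a fixed size, so rows \<open>p\<close> and \<open>q\<close>
  can afford only a small weight \<tau> for each further entry. The opposite row pays a large
  \<open>K\<close> with \<tau> K \<ge> e^2, and \<open>D\<close> pays for a whole row of weights
  \<open>K\<close>.\<close>

lemma pd_on_edge_test_large:
  assumes E: "symp E"
    and pq: "p < n" "q < n" "p \<noteq> q" and ab: "0 < a" "0 < b" "(cmod z)\<^sup>2 < a * b" and e: "0 \<le> e"
  obtains D0 where "\<And>D. D0 \<le> D \<Longrightarrow> pd_on n (restr E (edge_test p q a b z D e))"
proof -
  obtain k where k: "0 \<le> k" "k < 1" "k * a * (k * b) = (cmod z)\<^sup>2"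
    using sqrt_ratio_less_1[OF ab] by auto
  \<comment> \<open>Half of what is left over in the tighter of the rows \<open>p\<close> and
    \<open>q\<close>, or less, shared among n entries.\<close>
  define \<tau> where "\<tau> = (1 - k) * min a b / (2 * real n)"
  have n: "0 < real n" using pq by simp
  have \<tau>: "0 < \<tau>" unfolding \<tau>_def using k ab n by simp
  have "real n * \<tau> = (1 - k) * min a b / 2" using n by (simp add: \<tau>_def)
  moreover have "(1 - k) * min a b \<le> (1 - k) * a" "(1 - k) * min a b \<le> (1 - k) * b"
    using k by (intro mult_left_mono; simp)+
  moreover have "0 < (1 - k) * a" "0 < (1 - k) * b" using k ab by auto
  ultimately have slack: "k * a + real n * \<tau> < a" "k * b + real n * \<tau> < b"
    by (simp_all add: algebra_simps)
  \<comment> \<open>The summand e^2 / \<tau> serves pairs with one vertex in {p, q}; the summand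
    \<open>e\<close> serves pairs with none, where both weights are \<open>K\<close>.\<close>
  define K where "K = e + e\<^sup>2 / \<tau>"
  have K: "e \<le> K" "0 \<le> K" using e \<tau> by (simp_all add: K_def)
  have \<tau>K: "e\<^sup>2 \<le> \<tau> * K" using e \<tau> by (simp add: K_def field_simps power2_eq_square)
  have KK: "e\<^sup>2 \<le> K * K" unfolding power2_eq_square using K e by (intro mult_mono) auto
  define s where "s i j = (if i = p then (if j = q then k * a else 0) + \<tau>
    else if i = q then (if j = p then k * b else 0) + \<tau> else K)" for i j
  have s: "0 \<le> s i j" for i j using k ab \<tau> K by (simp add: s_def)
  show thesis
  proof (rule that[of "real n * K + 1"])
    fix D assume D: "real n * K + 1 \<le> D"
    let ?t = "edge_test p q a b z D e"
    show "pd_on n (restr E ?t)"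
    proof (rule pd_on_of_weights[of _ _ s])
      show "herm_on n (restr E ?t)" using herm_on_restr[OF herm_on_edge_test E] .
      show "0 \<le> s i j" for i j by (rule s)
      show "(\<Sum>j<n. s i j) < Re (restr E ?t i i)" if "i < n" for i
        using pq slack D by (simp add: s_def edge_test_def sum.distrib)
      fix i j :: nat assume ij: "i \<noteq> j"
      have "(cmod (?t i j))\<^sup>2 \<le> s i j * s j i"
      proof (cases "(i = p \<and> j = q) \<or> (i = q \<and> j = p)")
        case True
        have "(cmod z)\<^sup>2 \<le> (k * a + \<tau>) * (k * b + \<tau>)"
          unfolding k(3)[symmetric] using k ab \<tau> by (intro mult_mono) auto
        then show ?thesis
          using True ij by (auto simp: s_def edge_test_def mult_ac)
      next
        case False
        then have "(cmod (?t i j))\<^sup>2 = e\<^sup>2" using ij e by (auto simp: edge_test_def)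
        then show ?thesis
          using False ij \<tau>K KK by (auto simp: s_def mult.commute)
      qed
      moreover have "(cmod (restr E ?t i j))\<^sup>2 \<le> (cmod (?t i j))\<^sup>2"
        by (intro power_mono cmod_restr_le) auto
      ultimately show "(cmod (restr E ?t i j))\<^sup>2 \<le> s i j * s j i" by linarith
    qed
  qed
qed

text \<open>The pair {p, r} carries \<open>e\<close> like all remaining pairs, so nothing depends on
  whether the path closes to a triangle.\<close>

definition path_test :: "nat \<Rightarrow> nat \<Rightarrow> nat \<Rightarrow> real \<Rightarrow> real \<Rightarrow> real \<Rightarrow> real \<Rightarrow> real \<Rightarrow> nat \<Rightarrow> nat \<Rightarrow> real" where
  "path_test p q r b x y m e i j =
    (if i = j then if i = q then b else m
     else if {i, j} = {p, q} then x else if {i, j} = {q, r} then y else e)"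

lemma herm_on_path_test: "herm_on n (\<lambda>i j. of_real (path_test p q r b x y m e i j))"
  by (auto simp: herm_on_def path_test_def insert_commute)

text \<open>x^2 + y^2 < b m says that the Schur complement b - (x^2 + y^2) / m of the two ends is
  positive. With \<sigma> strictly between (x^2 + y^2) / b and m, each end row pays \<sigma> and the
  middle row pays x^2 / \<sigma> + y^2 / \<sigma> < b.\<close>

lemma pd_on_path_test_small:
  assumes E: "symp E"
    and pqr: "p < n" "q < n" "r < n" "p \<noteq> q" "q \<noteq> r" "p \<noteq> r"
    and m: "0 < m" and b: "0 < b" and xy: "0 < x" "0 < y" "x\<^sup>2 + y\<^sup>2 < b * m"
  obtains \<epsilon> where "0 < \<epsilon>"
    "\<And>e. 0 \<le> e \<Longrightarrow> e \<le> \<epsilon> \<Longrightarrow> pd_on n (restr E (\<lambda>i j. of_real (path_test p q r b x y m e i j)))"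
proof -
  obtain \<sigma> where \<sigma>: "(x\<^sup>2 + y\<^sup>2) / b < \<sigma>" "\<sigma> < m"
    using dense[of "(x\<^sup>2 + y\<^sup>2) / b" m] b xy(3) by (auto simp: field_simps)
  have x2: "0 < x\<^sup>2" "0 < y\<^sup>2" using xy by auto
  have "0 < (x\<^sup>2 + y\<^sup>2) / b" using x2 b by (intro divide_pos_pos add_pos_pos)
  with \<sigma> have \<sigma>: "0 < \<sigma>" "\<sigma> < m" "(x\<^sup>2 + y\<^sup>2) / b < \<sigma>" by simp_all
  have wb: "x\<^sup>2 / \<sigma> + y\<^sup>2 / \<sigma> < b" using \<sigma>(1,3) b by (simp add: field_simps)
  define s where "s i j = (if i = q then (if j = p then x\<^sup>2 / \<sigma> else 0) + (if j = r then y\<^sup>2 / \<sigma> else 0)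
    else if j = q then if i = p \<or> i = r then \<sigma> else 0 else 0)" for i j
  define d where "d i = (if i = q then b else m)" for i
  have s: "0 \<le> s i j" for i j using \<sigma> by (simp add: s_def)
  have dom: "(\<Sum>j<n. s i j) < d i" if "i < n" for i
    using pqr wb \<sigma> m by (auto simp add: s_def d_def sum.distrib)
  obtain \<epsilon> where e: "0 < \<epsilon>"
    "\<And>a. herm_on n a \<Longrightarrow> (\<And>i. i < n \<Longrightarrow> d i \<le> Re (a i i)) \<Longrightarrow>
      (\<And>i j. i < n \<Longrightarrow> j < n \<Longrightarrow> i \<noteq> j \<Longrightarrow> (cmod (a i j))\<^sup>2 \<le> s i j * s j i \<or> cmod (a i j) \<le> \<epsilon>) \<Longrightarrow>
      pd_on n a"
    using pd_on_of_weights_slack[of s n d, OF s dom] by blast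
  show thesis
  proof (rule that[OF e(1)])
    fix u :: real assume u: "0 \<le> u" "u \<le> \<epsilon>"
    let ?t = "\<lambda>i j. complex_of_real (path_test p q r b x y m u i j)"
    show "pd_on n (restr E ?t)"
    proof (rule e(2))
      show "herm_on n (restr E ?t)" using herm_on_restr[OF herm_on_path_test E] .
      show "d i \<le> Re (restr E ?t i i)" for i by (simp add: path_test_def d_def)
      fix i j :: nat assume ij: "i \<noteq> j"
      have le: "(cmod (restr E ?t i j))\<^sup>2 \<le> (path_test p q r b x y m u i j)\<^sup>2"
        using power_mono[OF cmod_restr_le[of E ?t i j], of 2] by simp
      consider "{i, j} = {p, q}" | "{i, j} \<noteq> {p, q}" "{i, j} = {q, r}"
        | "{i, j} \<noteq> {p, q}" "{i, j} \<noteq> {q, r}" by blast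
      then show "(cmod (restr E ?t i j))\<^sup>2 \<le> s i j * s j i \<or> cmod (restr E ?t i j) \<le> \<epsilon>"
      proof cases
        case 1
        then have "s i j * s j i = x\<^sup>2" using pqr \<sigma> by (auto simp: s_def doubleton_eq_iff)
        moreover have "path_test p q r b x y m u i j = x" using ij 1 by (simp add: path_test_def)
        ultimately show ?thesis using le by simp
      next
        case 2
        then have "s i j * s j i = y\<^sup>2" using pqr \<sigma> by (auto simp: s_def doubleton_eq_iff)
        moreover have "path_test p q r b x y m u i j = y" using ij 2 by (simp add: path_test_def)
        ultimately show ?thesis using le by simp
      next
        case 3
        then have "cmod (?t i j) \<le> \<epsilon>" using ij u by (simp add: path_test_def)
        then show ?thesis using cmod_restr_le[of E ?t i j] by linarith
      qed
    qed
  qed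
qed

section \<open>Values of a definiteness preserver\<close>

text \<open>\<open>P\<close> stands for either notion of definiteness; only its position between \<open>pd_on\<close> and
  \<open>psd_on\<close> matters.\<close>

locale definiteness_preserver =
  fixes n :: nat and E :: "nat \<Rightarrow> nat \<Rightarrow> bool" and \<Omega> :: "complex set"
    and f :: "complex \<Rightarrow> complex" and P :: "(nat \<Rightarrow> nat \<Rightarrow> complex) \<Rightarrow> bool"
  assumes E_sym: "symp E"
    and path: "\<exists>p q r. p < n \<and> q < n \<and> r < n \<and> p \<noteq> q \<and> q \<noteq> r \<and> p \<noteq> r \<and> E p q \<and> E q r"
    and pos_in: "0 < x \<Longrightarrow> complex_of_real x \<in> \<Omega>"
    and pd_imp: "pd_on n a \<Longrightarrow> P a"
    and imp_psd: "P a \<Longrightarrow> psd_on n a"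
    and preserves: "herm_on n a \<Longrightarrow> (\<And>i j. i < n \<Longrightarrow> j < n \<Longrightarrow> i = j \<or> E i j \<Longrightarrow> a i j \<in> \<Omega>) \<Longrightarrow>
      P (restr E a) \<longleftrightarrow> P (restr E (\<lambda>i j. f (a i j)))"
begin

section \<open>The positive axis: sign, monotonicity and growth\<close>

definition g :: "real \<Rightarrow> real" where
  "g x = Re (f (of_real x))"

lemma edge: obtains p q where "p < n" "q < n" "p \<noteq> q" "E p q"
  using path by blast

lemma edge_test_preserves:
  assumes "of_real a \<in> \<Omega>" "0 < b" "0 < D" "0 < e" "z \<in> \<Omega>" "cnj z \<in> \<Omega>"
  shows "P (restr E (edge_test p q a b z D e)) \<longleftrightarrow> P (restr E (\<lambda>i j. f (edge_test p q a b z D e i j)))"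
  by (rule preserves[OF herm_on_edge_test]) (auto simp: edge_test_def assms pos_in)

text \<open>\<open>x\<close> stands on the diagonal of a definite test matrix, so its image stands
  on the diagonal of a semidefinite one and is real and nonnegative. Strict positivity has to wait
  for strict monotonicity.\<close>

lemma f_pos:
  assumes "0 < x"
  shows "f (of_real x) = of_real (g x) \<and> 0 \<le> g x"
proof -
  obtain p q where pq: "p < n" "q < n" "p \<noteq> q" and "E p q" by (rule edge)
  have "(cmod (of_real (x / 2)))\<^sup>2 < x * x" using assms by (simp add: power2_eq_square)
  then obtain \<epsilon> where "0 < \<epsilon>" "pd_on n (restr E (edge_test p q x x (of_real (x / 2)) x \<epsilon>))"
    using pd_on_edge_test_exists[OF E_sym pq assms assms _ assms] by blast
  moreover have "of_real (x / 2) \<in> \<Omega>" "cnj (of_real (x / 2)) \<in> \<Omega>"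
    using pos_in[of "x / 2"] assms by auto
  ultimately have psd: "psd_on n (restr E (\<lambda>i j. f (edge_test p q x x (of_real (x / 2)) x \<epsilon> i j)))"
    using edge_test_preserves assms pd_imp imp_psd pos_in by blast
  have "restr E (\<lambda>i j. f (edge_test p q x x (of_real (x / 2)) x \<epsilon> i j)) p p = f (of_real x)"
    using pq by (simp add: edge_test_entries)
  moreover have "herm_on n (restr E (\<lambda>i j. f (edge_test p q x x (of_real (x / 2)) x \<epsilon> i j)))"
    using psd by (simp add: psd_on_def)
  ultimately show ?thesis
    using herm_on_diag[OF _ pq(1)] psd_on_diag[OF psd pq(1)] unfolding g_def by metis
qed

text \<open>That the value at \<open>a\<close> is real is assumed here, rather than derived from 0 <
  a, because \<open>f_neg\<close> puts a negative number in this position.\<close>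

lemma f_edge_test:
  assumes "0 < b" "0 < D" "0 < e" "f (cnj z) = cnj (f z)" "f (of_real a) = of_real (g a)"
  shows "(\<lambda>i j. f (edge_test p q a b z D e i j)) = edge_test p q (g a) (g b) (f z) (g D) (g e)"
  using assms f_pos by (auto simp: edge_test_def fun_eq_iff)

text \<open>One test matrix yields both claims: the positions (p, q) and (q, p) carry z and its
  conjugate, so a Hermitian image gives the conjugation rule, and its 2 x 2 minor gives the
  bound.\<close>

lemma f_edge_bound:
  assumes ab: "0 < a" "0 < b" "(cmod z)\<^sup>2 < a * b" and z: "z \<in> \<Omega>" "cnj z \<in> \<Omega>"
  shows "f (cnj z) = cnj (f z) \<and> (cmod (f z))\<^sup>2 \<le> g a * g b"
proof -
  obtain p q where pq: "p < n" "q < n" "p \<noteq> q" and E: "E p q" by (rule edge)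
  obtain \<epsilon> where "0 < \<epsilon>" "pd_on n (restr E (edge_test p q a b z 1 \<epsilon>))"
    using pd_on_edge_test_exists[OF E_sym pq ab zero_less_one_class.zero_less_one] by blast
  then have psd: "psd_on n (restr E (\<lambda>i j. f (edge_test p q a b z 1 \<epsilon> i j)))"
    using edge_test_preserves[OF pos_in[OF ab(1)] ab(2) zero_less_one_class.zero_less_one _ z] pd_imp imp_psd by blast
  have ent: "restr E (\<lambda>i j. f (edge_test p q a b z 1 \<epsilon> i j)) p q = f z"
    "restr E (\<lambda>i j. f (edge_test p q a b z 1 \<epsilon> i j)) q p = f (cnj z)"
    "restr E (\<lambda>i j. f (edge_test p q a b z 1 \<epsilon> i j)) p p = of_real (g a)"
    "restr E (\<lambda>i j. f (edge_test p q a b z 1 \<epsilon> i j)) q q = of_real (g b)"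
    using E sympD[OF E_sym E] pq f_pos ab by (simp_all add: restr_def edge_test_def)
  have "herm_on n (restr E (\<lambda>i j. f (edge_test p q a b z 1 \<epsilon> i j)))"
    using psd by (simp add: psd_on_def)
  from herm_onD[OF this pq(1,2)] psd_on_minor[OF psd pq] show ?thesis
    unfolding ent by simp
qed

text \<open>If \<open>g a = g c\<close>, then interchanging \<open>a\<close> and \<open>c\<close> in a test matrix does not change its image,
  but it destroys definiteness.\<close>

lemma g_inj:
  assumes "0 < a" "a < c"
  shows "g a \<noteq> g c"
proof
  assume eq: "g a = g c"
  have c: "0 < c" using assms by simp
  obtain p q where pq: "p < n" "q < n" "p \<noteq> q" and E: "E p q" by (rule edge)
  have "(cmod (of_real a))\<^sup>2 < c * c" using assms by (simp add: power2_eq_square mult_strict_mono)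
  then obtain \<epsilon> where e: "0 < \<epsilon>" "pd_on n (restr E (edge_test p q c c (of_real a) 1 \<epsilon>))"
    using pd_on_edge_test_exists[OF E_sym pq c c _ zero_less_one_class.zero_less_one] by blast
  have in': "of_real a \<in> \<Omega>" "cnj (of_real a) \<in> \<Omega>" "of_real c \<in> \<Omega>" "cnj (of_real c) \<in> \<Omega>"
    using pos_in assms c by auto
  have fa: "f (of_real a) = of_real (g a)" and fc: "f (of_real c) = of_real (g c)"
    using f_pos assms c by auto
  have "P (restr E (\<lambda>i j. f (edge_test p q c c (of_real a) 1 \<epsilon> i j)))"
    using edge_test_preserves[OF in'(3) c zero_less_one_class.zero_less_one e(1) in'(1,2)] e(2) pd_imp by blast
  moreover have "(\<lambda>i j. f (edge_test p q c c (of_real a) 1 \<epsilon> i j))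
      = (\<lambda>i j. f (edge_test p q a a (of_real c) 1 \<epsilon> i j))"
    using eq by (auto simp: edge_test_def fun_eq_iff fa fc)
  ultimately have "P (restr E (edge_test p q a a (of_real c) 1 \<epsilon>))"
    using edge_test_preserves[OF in'(1) assms(1) zero_less_one_class.zero_less_one e(1) in'(3,4)] by simp
  from psd_on_minor[OF imp_psd[OF this] pq] have "(cmod (of_real c))\<^sup>2 \<le> a * a"
    using E pq by (simp add: restr_edge edge_test_entries)
  moreover have "a * a < c * c" using assms by (simp add: mult_strict_mono)
  ultimately show False by (simp add: power2_eq_square)
qed

text \<open>The edge entry x between diagonal entries y, y gives only the weak inequality;
  injectivity makes it strict.\<close>

lemma g_strict_mono:
  assumes "0 < x" "x < y"
  shows "g x < g y"
proof -
  have "(cmod (of_real x))\<^sup>2 < y * y" using assms by (simp add: power2_eq_square mult_strict_mono)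
  then have "(cmod (f (of_real x)))\<^sup>2 \<le> g y * g y"
    using f_edge_bound[of y y "of_real x"] assms pos_in by simp
  then have "(g x)\<^sup>2 \<le> (g y)\<^sup>2"
    using f_pos[OF assms(1)] by (simp add: power2_eq_square)
  then have "g x \<le> g y" using f_pos[of y] assms by (auto intro: power2_le_imp_le)
  then show ?thesis using g_inj[OF assms] by simp
qed

lemma g_pos: "0 < x \<Longrightarrow> 0 < g x"
  using g_strict_mono[of "x / 2" x] f_pos[of "x / 2"] by simp

lemma g_geom_convex:
  assumes "0 < a" "0 < b" "0 < c" "c\<^sup>2 < a * b"
  shows "(g c)\<^sup>2 \<le> g a * g b"
  using f_edge_bound[of a b "of_real c"] assms pos_in f_pos[of c] by simp

text \<open>A finite supremum S would satisfy S^2 \<le> g(1) S by geometric convexity, hence S \<le>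
  g(1) < g(2) \<le> S.\<close>

lemma g_unbounded: "\<exists>x>0. M \<le> g x"
proof (rule ccontr)
  assume *: "\<not> (\<exists>x>0. M \<le> g x)"
  have M: "g x \<le> M" if "0 < x" for x using * that by (simp add: not_le less_imp_le)
  define S where "S = Sup (g ` {0<..})"
  have bdd: "bdd_above (g ` {0<..})" using M by (intro bdd_aboveI[of _ M]) auto
  have S_upper: "g x \<le> S" if "0 < x" for x
    unfolding S_def using bdd that by (intro cSup_upper) auto
  have S_pos: "0 < S" using S_upper[of 1] g_pos[of 1] by simp
  have "g c \<le> sqrt (g 1 * S)" if c: "0 < c" for c
  proof -
    \<comment> \<open>The added 1 makes c^2 < 1 * (c^2 + 1) strict.\<close>
    have "(g c)\<^sup>2 \<le> g 1 * g (c\<^sup>2 + 1)"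
      using c by (intro g_geom_convex) (auto simp: add_pos_pos)
    also have "\<dots> \<le> g 1 * S"
      using c g_pos[of 1] by (intro mult_left_mono S_upper) (auto simp: add_pos_pos)
    finally show ?thesis by (rule real_le_rsqrt)
  qed
  then have "Sup (g ` {0<..}) \<le> sqrt (g 1 * S)" by (intro cSup_least) auto
  then have "S \<le> sqrt (g 1 * S)" by (simp add: S_def)
  then have "S\<^sup>2 \<le> g 1 * S"
    using power_mono[of S "sqrt (g 1 * S)" 2] S_pos g_pos[of 1] by (simp add: less_imp_le)
  then have "S \<le> g 1" using S_pos by (simp add: power2_eq_square)
  moreover have "g 1 < g 2" "g 2 \<le> S" using g_strict_mono S_upper by auto
  ultimately show False by simp
qed

text \<open>The remaining edge entries cannot be made small yet, since \<open>g\<close> might have a positive limit at \<open>0\<close>;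
  large diagonal entries compensate for them.\<close>

lemma g_geom_concave:
  assumes ab: "0 < a" "0 < b" and c: "0 < c" and lt: "(g c)\<^sup>2 < g a * g b"
  shows "c\<^sup>2 \<le> a * b"
proof -
  obtain p q where pq: "p < n" "q < n" "p \<noteq> q" and E: "E p q" by (rule edge)
  have fc: "f (of_real c) = of_real (g c)" using f_pos c by blast
  have "(cmod (f (of_real c)))\<^sup>2 < g a * g b" using lt by (simp add: fc)
  then obtain D0 where D0: "\<And>D. D0 \<le> D \<Longrightarrow> pd_on n (restr E (edge_test p q (g a) (g b) (f (of_real c)) D (g 1)))"
    using pd_on_edge_test_large[OF E_sym pq g_pos[OF ab(1)] g_pos[OF ab(2)]] g_pos[of 1]
    by (metis less_imp_le zero_less_one_class.zero_less_one)
  \<comment> \<open>The threshold \<open>D0\<close> concerns the image, so \<open>D\<close> is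
    chosen through \<open>g\<close>. The other edges carry 1 in the matrix and \<open>g 1\<close> in
    the image.\<close>
  obtain D where D: "0 < D" "D0 \<le> g D" using g_unbounded by blast
  have "P (restr E (\<lambda>i j. f (edge_test p q a b (of_real c) D 1 i j)))"
    using D0[OF D(2)] ab D f_pos fc by (subst f_edge_test) (auto intro: pd_imp)
  then have "P (restr E (edge_test p q a b (of_real c) D 1))"
    using edge_test_preserves ab c D pos_in by simp
  from psd_on_minor[OF imp_psd[OF this] pq] show ?thesis
    using E pq by (simp add: restr_edge edge_test_entries)
qed

section \<open>Multiplicativity on squares, continuity and decay at 0\<close>

lemma g_square: "0 < c \<Longrightarrow> g 1 * g (c\<^sup>2) = (g c)\<^sup>2"
  by (rule mult_preserving_square[OF g_strict_mono g_pos g_geom_convex g_geom_concave])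

lemma isCont_g: "0 < c \<Longrightarrow> isCont g c"
  by (rule isCont_geometrically_convex[OF g_strict_mono g_pos g_geom_convex])

lemma g_small:
  assumes "0 < e" "0 < u"
  obtains d where "0 < d" "d \<le> u" "g d < e"
proof -
  obtain d where d: "0 < d" "g d < e"
    using small_value_of_mult_square[OF g_strict_mono g_pos g_square assms(1)] by blast
  then have "g (min d u) \<le> g d"
    using g_strict_mono[of "min d u" d] assms by (cases "d \<le> u") auto
  then show thesis using that[of "min d u"] d assms by auto
qed

section \<open>Additivity from paths on three vertices\<close>

lemma path_test_preserves:
  assumes "0 < b" "0 < x" "0 < y" "0 < m" "0 < e"
  shows "P (restr E (\<lambda>i j. of_real (path_test p q r b x y m e i j))) \<longleftrightarrow>
    P (restr E (\<lambda>i j. of_real (path_test p q r (g b) (g x) (g y) (g m) (g e) i j)))"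
proof -
  have "(\<lambda>i j. f (of_real (path_test p q r b x y m e i j)))
      = (\<lambda>i j. of_real (path_test p q r (g b) (g x) (g y) (g m) (g e) i j))"
    by (intro ext) (simp add: path_test_def f_pos assms)
  moreover have "P (restr E (\<lambda>i j. of_real (path_test p q r b x y m e i j))) \<longleftrightarrow>
      P (restr E (\<lambda>i j. f (of_real (path_test p q r b x y m e i j))))"
    by (rule preserves[OF herm_on_path_test]) (simp add: path_test_def pos_in assms)
  ultimately show ?thesis by simp
qed

lemma path_test_necessary:
  assumes P: "P (restr E (\<lambda>i j. of_real (path_test p q r b x y m e i j)))"
    and pqr: "p < n" "q < n" "r < n" "p \<noteq> q" "q \<noteq> r" "p \<noteq> r" "E p q" "E q r"
    and m: "0 < m" and nonneg: "0 \<le> x" "0 \<le> y" "0 \<le> e"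
  shows "(x\<^sup>2 + y\<^sup>2) / m \<le> b + 2 * e * x * y / m\<^sup>2"
proof -
  \<comment> \<open>If {p, r} is not an edge, its entry is cut to 0, and the error term can only
    shrink.\<close>
  define e' where "e' = (if E p r then e else 0)"
  have "0 \<le> b - (x\<^sup>2 + y\<^sup>2) / m + 2 * e' * x * y / m\<^sup>2"
    by (rule psd_on_path[OF imp_psd[OF P] pqr(1-6) _ _ _ _ _ _ m])
      (use pqr in \<open>simp_all add: restr_def path_test_def e'_def doubleton_eq_iff\<close>)
  moreover have "2 * e' * x * y / m\<^sup>2 \<le> 2 * e * x * y / m\<^sup>2"
    using nonneg by (intro divide_right_mono mult_right_mono) (auto simp: e'_def)
  ultimately show ?thesis by linarith
qed

text \<open>With 1 on the end diagonals, the Schur complement of the middle vertex is b - x^2 - y^2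
  before the map and g(b) - (g(x)^2 + g(y)^2) / g(1) after it, up to the entry between the ends.
  \<open>g_square\<close> turns g(x)^2 / g(1) into g(x^2), which is why the arguments are
  squares.\<close>

lemma g_superadd:
  assumes x: "0 < x" and y: "0 < y" and b: "x\<^sup>2 + y\<^sup>2 < b"
  shows "g (x\<^sup>2) + g (y\<^sup>2) \<le> g b"
proof -
  obtain p q r where pqr: "p < n" "q < n" "r < n" "p \<noteq> q" "q \<noteq> r" "p \<noteq> r" "E p q" "E q r"
    using path by blast
  have b0: "0 < b" using b sum_power2_ge_zero[of x y] by linarith
  have lt: "x\<^sup>2 + y\<^sup>2 < b * 1" using b by simp
  obtain \<epsilon> where e: "0 < \<epsilon>"
    "\<And>e. 0 \<le> e \<Longrightarrow> e \<le> \<epsilon> \<Longrightarrow> pd_on n (restr E (\<lambda>i j. of_real (path_test p q r b x y 1 e i j)))"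
    using pd_on_path_test_small[OF E_sym pqr(1-6) zero_less_one_class.zero_less_one b0 x y lt] by blast
  have g1: "0 < g 1" using g_pos by simp
  have "((g x)\<^sup>2 + (g y)\<^sup>2) / g 1 \<le> g b"
  proof (rule small_multiple[where K = "2 * g x * g y / (g 1)\<^sup>2"])
    show "0 \<le> 2 * g x * g y / (g 1)\<^sup>2" using g_pos x y by (simp add: less_imp_le)
    fix \<delta> :: real assume "0 < \<delta>"
    then obtain d where d: "0 < d" "d \<le> \<epsilon>" "g d < \<delta>" using g_small e(1) by blast
    have "P (restr E (\<lambda>i j. of_real (path_test p q r (g b) (g x) (g y) (g 1) (g d) i j)))"
      using pd_imp[OF e(2)[of d]] d path_test_preserves[OF b0 x y zero_less_one_class.zero_less_one d(1), of p q r] by simp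
    from path_test_necessary[OF this pqr g1] g_pos[OF x] g_pos[OF y] g_pos[OF d(1)]
    have "((g x)\<^sup>2 + (g y)\<^sup>2) / g 1 \<le> g b + 2 * g d * g x * g y / (g 1)\<^sup>2" by simp
    then show "\<exists>e<\<delta>. ((g x)\<^sup>2 + (g y)\<^sup>2) / g 1 \<le> g b + e * (2 * g x * g y / (g 1)\<^sup>2)"
      using d(3) by (intro exI[of _ "g d"]) (simp add: mult_ac)
  qed
  then show ?thesis
    using g1 by (simp add: g_square[OF x, symmetric] g_square[OF y, symmetric] add_divide_distrib)
qed

text \<open>The converse passage: a violation makes the image definite once \<open>g d\<close> is
  small, and semidefiniteness of the original matrix then forces x^2 + y^2 \<le> b up to an error
  proportional to \<open>d\<close>.\<close>

lemma g_subadd: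
  assumes x: "0 < x" and y: "0 < y" and b0: "0 < b" and b: "b < x\<^sup>2 + y\<^sup>2"
  shows "g b \<le> g (x\<^sup>2) + g (y\<^sup>2)"
proof (rule ccontr)
  assume "\<not> g b \<le> g (x\<^sup>2) + g (y\<^sup>2)"
  then have "g 1 * (g (x\<^sup>2) + g (y\<^sup>2)) < g 1 * g b" using g_pos[of 1] by simp
  then have lt: "(g x)\<^sup>2 + (g y)\<^sup>2 < g b * g 1"
    by (simp add: distrib_left g_square[OF x] g_square[OF y] mult.commute)
  obtain p q r where pqr: "p < n" "q < n" "r < n" "p \<noteq> q" "q \<noteq> r" "p \<noteq> r" "E p q" "E q r"
    using path by blast
  obtain \<epsilon> where e: "0 < \<epsilon>"
    "\<And>e. 0 \<le> e \<Longrightarrow> e \<le> \<epsilon> \<Longrightarrow> pd_on n (restr E (\<lambda>i j. of_real (path_test p q r (g b) (g x) (g y) (g 1) e i j)))"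
    using pd_on_path_test_small[OF E_sym pqr(1-6) g_pos[OF zero_less_one_class.zero_less_one] g_pos[OF b0] g_pos[OF x] g_pos[OF y] lt]
    by blast
  have "x\<^sup>2 + y\<^sup>2 \<le> b"
  proof (rule small_multiple[where K = "2 * x * y"])
    show "0 \<le> 2 * x * y" using x y by simp
    fix \<delta> :: real assume "0 < \<delta>"
    then obtain d where d: "0 < d" "d \<le> \<delta> / 2" "g d < \<epsilon>" using g_small[OF e(1), of "\<delta> / 2"] by auto
    have "P (restr E (\<lambda>i j. of_real (path_test p q r b x y 1 d i j)))"
      using pd_imp[OF e(2)[of "g d"]] d g_pos[OF d(1)] path_test_preserves[OF b0 x y zero_less_one_class.zero_less_one d(1), of p q r]
      by simp
    from path_test_necessary[OF this pqr zero_less_one_class.zero_less_one] x y d(1)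
    have "x\<^sup>2 + y\<^sup>2 \<le> b + 2 * d * x * y" by simp
    then show "\<exists>e<\<delta>. x\<^sup>2 + y\<^sup>2 \<le> b + e * (2 * x * y)"
      using d \<open>0 < \<delta>\<close> by (intro exI[of _ d]) (simp add: mult_ac)
  qed
  then show False using b by simp
qed

lemma g_add:
  assumes "0 < X" "0 < Y"
  shows "g (X + Y) = g X + g Y"
proof (rule antisym)
  have sq: "X = (sqrt X)\<^sup>2" "Y = (sqrt Y)\<^sup>2" "0 < sqrt X" "0 < sqrt Y" using assms by auto
  have cont: "isCont g (X + Y)" and XY: "0 < X + Y" using isCont_g assms by auto
  show "g (X + Y) \<le> g X + g Y"
    using isCont_ge_of_left[OF cont XY] g_subadd[OF sq(3,4)] sq(1,2) by auto
  show "g X + g Y \<le> g (X + Y)"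
    using isCont_le_of_right[OF cont] g_superadd[OF sq(3,4)] sq(1,2) by auto
qed

lemma g_linear: "0 < x \<Longrightarrow> g x = g 1 * x"
  by (rule additive_mono_linear[OF g_strict_mono g_pos g_add])

text \<open>Between diagonal entries 1 and b, the entry z is admissible for b > |z|^2 and its image
  for g(1)^2 b > |f(z)|^2. The two thresholds for b have to coincide.\<close>

lemma f_edge:
  assumes z: "z \<in> \<Omega>" "cnj z \<in> \<Omega>"
  shows "f (cnj z) = cnj (f z)" and "cmod (f z) = g 1 * cmod z"
proof -
  have g1: "0 < g 1" using g_pos by simp
  have "(cmod z)\<^sup>2 < 1 * ((cmod z)\<^sup>2 + 1)" by simp
  then show cnj: "f (cnj z) = cnj (f z)"
    using f_edge_bound[OF zero_less_one_class.zero_less_one _ _ z, of "(cmod z)\<^sup>2 + 1"] by (simp add: add_nonneg_pos)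
  have "(cmod (f z))\<^sup>2 \<le> (g 1)\<^sup>2 * (cmod z)\<^sup>2"
  proof (rule field_le_epsilon)
    fix e :: real assume e: "0 < e"
    \<comment> \<open>Chosen so that g(1)^2 b exceeds g(1)^2 |z|^2 by exactly
      \<open>e\<close>.\<close>
    define b where "b = (cmod z)\<^sup>2 + e / (g 1)\<^sup>2"
    have "0 < e / (g 1)\<^sup>2" using e g1 by simp
    then have b: "0 < b" "(cmod z)\<^sup>2 < 1 * b" by (simp_all add: b_def add_nonneg_pos)
    have "(cmod (f z))\<^sup>2 \<le> g 1 * g b"
      using f_edge_bound[OF zero_less_one_class.zero_less_one b z] by simp
    also have "\<dots> = (g 1)\<^sup>2 * b" using g_linear[OF b(1)] by (simp add: power2_eq_square)
    also have "\<dots> = (g 1)\<^sup>2 * (cmod z)\<^sup>2 + e" using g1 by (simp add: b_def distrib_left)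
    finally show "(cmod (f z))\<^sup>2 \<le> (g 1)\<^sup>2 * (cmod z)\<^sup>2 + e" .
  qed
  moreover have "(g 1)\<^sup>2 * (cmod z)\<^sup>2 \<le> (cmod (f z))\<^sup>2"
  proof (rule ccontr)
    assume "\<not> (g 1)\<^sup>2 * (cmod z)\<^sup>2 \<le> (cmod (f z))\<^sup>2"
    then have "(cmod (f z))\<^sup>2 / (g 1)\<^sup>2 < (cmod z)\<^sup>2" using g1 by (simp add: field_simps)
    then obtain b where b: "(cmod (f z))\<^sup>2 / (g 1)\<^sup>2 < b" "b < (cmod z)\<^sup>2" using dense by blast
    have b0: "0 < b" using b(1) by (meson divide_nonneg_nonneg le_less_trans zero_le_power2)
    have gb: "g b = g 1 * b" using g_linear[OF b0] .
    have lt: "(cmod (f z))\<^sup>2 < g 1 * g b"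
      using b(1) g1 unfolding gb by (simp add: field_simps power2_eq_square)
    obtain p q where pq: "p < n" "q < n" "p \<noteq> q" and E: "E p q" by (rule edge)
    obtain \<epsilon> where e: "0 < \<epsilon>"
      "\<And>e. 0 \<le> e \<Longrightarrow> e \<le> \<epsilon> \<Longrightarrow> pd_on n (restr E (edge_test p q (g 1) (g b) (f z) (g 1) e))"
      using pd_on_edge_test_small[OF E_sym pq g1 g_pos[OF b0] lt g1] by blast
    obtain d where d: "0 < d" "g d < \<epsilon>" using g_small[OF e(1) zero_less_one_class.zero_less_one] by blast
    have "P (restr E (\<lambda>i j. f (edge_test p q 1 b z 1 d i j)))"
      using e(2)[of "g d"] d g_pos[OF d(1)] b0 cnj f_pos[of 1]
      by (subst f_edge_test) (auto intro!: pd_imp)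
    then have "P (restr E (edge_test p q 1 b z 1 d))"
      using edge_test_preserves[OF _ b0 zero_less_one_class.zero_less_one d(1) z] pos_in[of 1] by simp
    from psd_on_minor[OF imp_psd[OF this] pq] have "(cmod z)\<^sup>2 \<le> b"
      using E pq by (simp add: restr_edge edge_test_entries)
    then show False using b by simp
  qed
  ultimately have "(cmod (f z))\<^sup>2 = (g 1 * cmod z)\<^sup>2" by (simp add: power_mult_distrib)
  then show "cmod (f z) = g 1 * cmod z"
    using g1 by (simp add: power2_eq_iff_nonneg less_imp_le)
qed

text \<open>The value is real of known modulus, so only its sign is open. A positive value would
  allow a definite image of a matrix with -x on its diagonal.\<close>

lemma f_neg:
  assumes x: "0 < x" and in': "of_real (- x) \<in> \<Omega>"
  shows "f (of_real (- x)) = of_real (g 1 * - x)"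
proof -
  have g1: "0 < g 1" using g_pos by simp
  have in'': "cnj (of_real (- x)) \<in> \<Omega>" using in' by simp
  have real: "f (of_real (- x)) = of_real (g (- x))"
    using f_edge(1)[OF in' in''] unfolding g_def
    by (metis Reals_cnj_iff complex_cnj_complex_of_real of_real_Re)
  have "\<bar>g (- x)\<bar> = g 1 * x" using f_edge(2)[OF in' in''] x by (simp add: real[simplified])
  then consider "g (- x) = g 1 * - x" | "g (- x) = g 1 * x" by (auto simp: abs_if split: if_splits)
  then show ?thesis
  proof cases
    case 1
    then show ?thesis using real by simp
  next
    case 2
    obtain p q where pq: "p < n" "q < n" "p \<noteq> q" and E: "E p q" by (rule edge)
    \<comment> \<open>c^2 = x / 4 < x, so g(c)^2 is below the product of the supposed diagonal
      values g(1) x and g(1).\<close>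
    define c where "c = sqrt x / 2"
    have c: "0 < c" using x by (simp add: c_def)
    have "c\<^sup>2 < x" using x by (simp add: c_def power_divide)
    then have lt: "(cmod (of_real (g c)))\<^sup>2 < g 1 * x * g 1"
      unfolding norm_of_real power2_abs g_linear[OF c]
      using g1 by (simp add: power_mult_distrib) (simp add: power2_eq_square)
    obtain \<epsilon> where e: "0 < \<epsilon>"
      "\<And>e. 0 \<le> e \<Longrightarrow> e \<le> \<epsilon> \<Longrightarrow> pd_on n (restr E (edge_test p q (g 1 * x) (g 1) (of_real (g c)) (g 1) e))"
      using pd_on_edge_test_small[OF E_sym pq _ g1 lt g1] g1 x by auto
    obtain d where d: "0 < d" "g d < \<epsilon>" using g_small[OF e(1) zero_less_one_class.zero_less_one] by blast
    have "P (restr E (\<lambda>i j. f (edge_test p q (- x) 1 (of_real c) 1 d i j)))"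
      using e(2)[of "g d"] d g_pos[OF d(1)] 2 f_pos[OF c] real
      by (subst f_edge_test) (auto intro!: pd_imp)
    then have "P (restr E (edge_test p q (- x) 1 (of_real c) 1 d))"
      using edge_test_preserves[OF in' zero_less_one_class.zero_less_one zero_less_one_class.zero_less_one d(1)] pos_in[OF c] by simp
    from psd_on_diag[OF imp_psd[OF this] pq(1)] show ?thesis
      using pq x by (simp add: edge_test_entries)
  qed
qed

lemma f_real:
  assumes "of_real x \<in> \<Omega>"
  shows "f (of_real x) = of_real (g 1) * of_real x"
proof -
  consider "0 < x" | "x = 0" | "0 < - x" by linarith
  then show ?thesis
  proof cases
    case 1
    then show ?thesis using f_pos[OF 1] g_linear[OF 1] by simp
  next
    case 2
    then show ?thesis using f_edge(2)[of 0] assms by simp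
  next
    case 3
    then show ?thesis using f_neg[OF 3] assms by simp
  qed
qed

end

section \<open>Cycles\<close>

text \<open>Up to the phase u on the first edge, the entries 2 and -1 are those of the Laplacian of
  the path 0, ..., m; \<open>d\<close> replaces the degree 1 at its ends, and z closes the cycle.
  For m \<ge> 2 the closing pair is not consecutive.\<close>

definition cycle_entry :: "nat \<Rightarrow> real \<Rightarrow> complex \<Rightarrow> complex \<Rightarrow> nat \<Rightarrow> nat \<Rightarrow> complex" where
  "cycle_entry m d u z i j =
    (if i = j then if i = 0 \<or> i = m then of_real d else 2
     else if j = Suc i then if i = 0 then cnj u else - 1
     else if i = Suc j then if j = 0 then u else - 1
     else if i = 0 \<and> j = m then cnj z else if i = m \<and> j = 0 then z else 0)"

lemma herm_on_cycle_entry: "herm_on n (cycle_entry m d u z)"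
  unfolding herm_on_def cycle_entry_def by simp

text \<open>Changing the phase at vertex \<open>0\<close> turns the path part of the form into the Laplacian of a path.\<close>

definition cycle_lift :: "complex \<Rightarrow> (nat \<Rightarrow> complex) \<Rightarrow> nat \<Rightarrow> complex" where
  "cycle_lift u x i = (if i = 0 then - u * x 0 else x i)"

text \<open>The lift turns every path entry into -1, so path terms combine to squared differences.
  These use up 1 of each end diagonal, leaving d - 1, and the phase removed from vertex 0 reappears
  at the closing entry as z * cnj u.\<close>

lemma qform_cycle_entry:
  assumes m: "2 \<le> m" and u: "cmod u = 1"
  shows "qform (Suc m) (cycle_entry m d u z) x =
    (\<Sum>i<m. (cmod (cycle_lift u x i - cycle_lift u x (Suc i)))\<^sup>2)
    + (d - 1) * ((cmod (cycle_lift u x 0))\<^sup>2 + (cmod (cycle_lift u x m))\<^sup>2)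
    - 2 * Re (z * cnj u * cycle_lift u x 0 * cnj (cycle_lift u x m))"
proof -
  define N where "N i = (cmod (x i))\<^sup>2" for i
  define y where "y i = (if i = 0 then u else - 1)" for i :: nat
  define D where "D i = (if i = 0 \<or> i = m then d else 2)" for i
  have uu: "u * cnj u = 1" using u by (simp add: complex_norm_square[symmetric])
  \<comment> \<open>The matrix is split into diagonal, upper and lower neighbours and two corners,
    which are then summed separately; at most one summand is active for each pair because m \<ge>
    2.\<close>
  have entry: "Re (cnj (x i) * cycle_entry m d u z i j * x j) =
      (if j = i then D i * N i else 0)
      + (if j = Suc i then Re (y i * x i * cnj (x (Suc i))) else 0)
      + (if i = Suc j then Re (y j * x j * cnj (x i)) else 0)
      + (if i = 0 then if j = m then Re (z * x 0 * cnj (x m)) else 0 else 0)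
      + (if i = m then if j = 0 then Re (z * x 0 * cnj (x m)) else 0 else 0)" for i j
  proof -
    have N: "Re (cnj w * of_real r * w) = r * (cmod w)\<^sup>2" for w r
      unfolding cmod_power2 by (simp add: algebra_simps power2_eq_square)
    have cn: "Re (cnj v * cnj w * v') = Re (w * v * cnj v')" for v w v'
      by (simp add: algebra_simps)
    have re: "Re (cnj v' * w * v) = Re (w * v * cnj v')" for v w v'
      by (simp add: algebra_simps)
    consider "i = j" | "i \<noteq> j" "j = Suc i" | "i \<noteq> j" "j \<noteq> Suc i" "i = Suc j"
      | "i \<noteq> j" "j \<noteq> Suc i" "i \<noteq> Suc j" by blast
    then show ?thesis
    proof cases
      case 1
      have "cycle_entry m d u z i i = of_real (D i)" by (simp add: cycle_entry_def D_def)
      then show ?thesis using 1 m N[of "x i" "D i"] by (simp add: N_def)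
    next
      case 2
      have "cycle_entry m d u z i j = cnj (y i)" using 2 by (simp add: cycle_entry_def y_def)
      then show ?thesis using 2 m cn[of "x i" "y i" "x j"] by simp
    next
      case 3
      have "cycle_entry m d u z i j = y j" using 3 by (simp add: cycle_entry_def y_def)
      then show ?thesis using 3 m re[of "x i" "y j" "x j"] by simp
    next
      case 4
      then show ?thesis
        using cn[of "x 0" z "x m"] re[of "x m" z "x 0"] by (simp add: cycle_entry_def)
    qed
  qed
  have shift: "(\<Sum>i<Suc m. \<Sum>j<Suc m. if i = Suc j then F j else 0) = (\<Sum>j<m. F j)" for F :: "nat \<Rightarrow> real"
  proof -
    have "(\<Sum>i<Suc m. \<Sum>j<Suc m. if i = Suc j then F j else 0)
        = (\<Sum>j<Suc m. \<Sum>i<Suc m. if i = Suc j then F j else 0)" by (rule sum.swap)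
    also have "\<dots> = (\<Sum>j<Suc m. if j < m then F j else 0)"
      by (intro sum.cong refl) (subst sum.delta, auto)
    also have "\<dots> = (\<Sum>j<m. F j)" by simp
    finally show ?thesis .
  qed
  have shift': "(\<Sum>i<Suc m. \<Sum>j<Suc m. if j = Suc i then F i else 0) = (\<Sum>j<m. F j)" for F :: "nat \<Rightarrow> real"
    by (subst sum.swap) (rule shift)
  have shift'': "(\<Sum>i<Suc m. \<Sum>j<Suc m. if i = Suc j then Re (y j * x j * cnj (x i)) else 0)
      = (\<Sum>j<m. Re (y j * x j * cnj (x (Suc j))))"
    unfolding shift[symmetric] by (intro sum.cong) auto
  have diag: "(\<Sum>i<Suc m. \<Sum>j<Suc m. if j = i then F i else 0) = (\<Sum>i<Suc m. F i)" for F :: "nat \<Rightarrow> real"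
    by (intro sum.cong refl) (simp del: sum.lessThan_Suc)
  have corner: "(\<Sum>i<Suc m. \<Sum>j<Suc m. if i = p then if j = q then K else 0 else 0) = K"
    if "p \<le> m" "q \<le> m" for p q and K :: real
  proof -
    have "(\<Sum>j<Suc m. if i = p then if j = q then K else 0 else 0) = (if i = p then K else 0)" for i
      using that by (cases "i = p") (simp_all del: sum.lessThan_Suc)
    then show ?thesis using that by (simp del: sum.lessThan_Suc)
  qed
  have lhs: "qform (Suc m) (cycle_entry m d u z) x =
      (\<Sum>i<Suc m. D i * N i) + 2 * (\<Sum>j<m. Re (y j * x j * cnj (x (Suc j)))) + 2 * Re (z * x 0 * cnj (x m))"
    unfolding qform_def entry sum.distrib shift' shift'' diag
      corner[OF le0 order_refl] corner[OF order_refl le0] by simp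
  \<comment> \<open>Summing over edges counts interior vertices twice and the ends once.\<close>
  have split: "(\<Sum>i<m. N i + N (Suc i)) = (\<Sum>i<Suc m. D i * N i) - (d - 1) * (N 0 + N m)"
  proof -
    obtain k where k: "m = Suc k" using m by (cases m) auto
    have "(\<Sum>i<m. D i * N i) = D 0 * N 0 + (\<Sum>i<k. D (Suc i) * N (Suc i))"
      unfolding k by (rule sum.lessThan_Suc_shift)
    also have "(\<Sum>i<k. D (Suc i) * N (Suc i)) = 2 * (\<Sum>i<k. N (Suc i))"
      unfolding sum_distrib_left by (intro sum.cong) (auto simp: D_def k)
    finally have "(\<Sum>i<Suc m. D i * N i) = d * N 0 + 2 * (\<Sum>i<k. N (Suc i)) + d * N m"
      by (simp add: D_def)
    moreover have "(\<Sum>i<m. N i) = N 0 + (\<Sum>i<k. N (Suc i))"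
      unfolding k by (rule sum.lessThan_Suc_shift)
    moreover have "(\<Sum>i<m. N (Suc i)) = (\<Sum>i<k. N (Suc i)) + N m"
      unfolding k by simp
    ultimately show ?thesis by (simp add: sum.distrib sum_distrib_left[symmetric] algebra_simps)
  qed
  have sq: "(cmod (cycle_lift u x i - cycle_lift u x (Suc i)))\<^sup>2
      = N i + N (Suc i) + 2 * Re (y i * x i * cnj (x (Suc i)))" for i
  proof -
    have diff: "(cmod (v - w))\<^sup>2 = (cmod v)\<^sup>2 + (cmod w)\<^sup>2 - 2 * Re (v * cnj w)" for v w
      unfolding cmod_power2 by (simp add: algebra_simps power2_eq_square)
    have lift: "cycle_lift u x i = - (y i * x i)" "cycle_lift u x (Suc i) = x (Suc i)"
      by (simp_all add: cycle_lift_def y_def)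
    have norm: "cmod (- (y i * x i)) = cmod (x i)"
      using u by (simp add: norm_mult y_def)
    show ?thesis unfolding lift diff norm N_def by simp
  qed
  have lift: "cycle_lift u x 0 = - (u * x 0)" "cycle_lift u x m = x m"
    using m by (simp_all add: cycle_lift_def)
  have "z * cnj u * (- (u * x 0)) * cnj (x m) = - ((u * cnj u) * (z * x 0 * cnj (x m)))"
    by (simp only: mult_ac mult_minus_left mult_minus_right)
  then have close: "Re (z * cnj u * cycle_lift u x 0 * cnj (cycle_lift u x m)) = - Re (z * x 0 * cnj (x m))"
    unfolding lift uu by (simp only: mult_1_left uminus_complex.sel)
  have ends: "(cmod (cycle_lift u x 0))\<^sup>2 = N 0" "(cmod (cycle_lift u x m))\<^sup>2 = N m"
    using u m by (simp_all add: cycle_lift_def N_def norm_mult)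
  show ?thesis
    unfolding lhs close ends sq sum.distrib[of "\<lambda>i. N i + N (Suc i)"] split
    by (simp add: sum_distrib_left)
qed

text \<open>Cauchy-Schwarz for the m increments, obtained by subtracting their mean \<open>s\<close>
  and using that the remaining squares are nonnegative.\<close>

lemma norm_diff_le_path_energy:
  fixes X :: "nat \<Rightarrow> complex"
  assumes "0 < m"
  shows "(cmod (X 0 - X m))\<^sup>2 / real m \<le> (\<Sum>i<m. (cmod (X i - X (Suc i)))\<^sup>2)"
proof -
  define s where "s = (X 0 - X m) / of_nat m"
  have tel: "(\<Sum>i<m. X i - X (Suc i)) = of_nat m * s"
    using assms by (simp add: sum_lessThan_telescope' s_def)
  have sq: "(cmod (v - s))\<^sup>2 = (cmod v)\<^sup>2 + (cmod s)\<^sup>2 - 2 * Re (v * cnj s)" for v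
    unfolding cmod_power2 by (simp add: algebra_simps power2_eq_square)
  have "0 \<le> (\<Sum>i<m. (cmod (X i - X (Suc i) - s))\<^sup>2)" by (intro sum_nonneg) auto
  also have "\<dots> = (\<Sum>i<m. (cmod (X i - X (Suc i)))\<^sup>2) + m * (cmod s)\<^sup>2
      - 2 * Re ((\<Sum>i<m. X i - X (Suc i)) * cnj s)"
    unfolding sq sum_distrib_right by (simp add: sum.distrib sum_subtractf sum_distrib_left)
  also have "Re ((\<Sum>i<m. X i - X (Suc i)) * cnj s) = m * (cmod s)\<^sup>2"
    unfolding tel cmod_power2 by (simp add: algebra_simps power2_eq_square)
  finally have "m * (cmod s)\<^sup>2 \<le> (\<Sum>i<m. (cmod (X i - X (Suc i)))\<^sup>2)" by simp
  moreover have "m * (cmod s)\<^sup>2 = (cmod (X 0 - X m))\<^sup>2 / real m"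
    using assms by (simp add: s_def norm_divide power_divide power2_eq_square)
  ultimately show ?thesis by simp
qed

text \<open>Eliminating the interior vertices of the path leaves a binary form whose off-diagonal
  entry is \<open>- (z * cnj u + 1 / m)\<close>.\<close>

lemma endpoint_form:
  fixes X Y z u :: complex and m :: nat
  shows "(cmod (X - Y))\<^sup>2 / m + (t - 1 / m) * ((cmod X)\<^sup>2 + (cmod Y)\<^sup>2) - 2 * Re (z * cnj u * X * cnj Y)
    = t * ((cmod X)\<^sup>2 + (cmod Y)\<^sup>2) - 2 * Re ((z * cnj u + 1 / of_nat m) * X * cnj Y)"
proof -
  define W where "W = (cmod X)\<^sup>2 + (cmod Y)\<^sup>2"
  have diff: "(cmod (X - Y))\<^sup>2 = W - 2 * Re (X * cnj Y)"
    unfolding cmod_power2 W_def by (simp add: algebra_simps power2_eq_square)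
  have prod: "Re ((z * cnj u + 1 / of_nat m) * X * cnj Y)
      = Re (z * cnj u * X * cnj Y) + Re (X * cnj Y) / m"
  proof -
    have "(z * cnj u + 1 / of_nat m) * X * cnj Y = z * cnj u * X * cnj Y + X * cnj Y / of_nat m"
      by (simp add: algebra_simps)
    then show ?thesis by (simp only: plus_complex.sel Re_divide_of_nat)
  qed
  show ?thesis
    unfolding W_def[symmetric] diff prod
    by (simp only: diff_divide_distrib left_diff_distrib) (simp only: mult.assoc ring_distribs, simp)
qed

text \<open>The diagonal value t - 1/m + 1 is tuned so that the binary form at the ends has diagonal
  t. This form is positive definite once t exceeds the modulus of its off-diagonal entry.\<close>

lemma qform_cycle_entry_pos:
  assumes m: "2 \<le> m" and u: "cmod u = 1" and t: "cmod (z * cnj u + 1 / of_nat m) < t"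
    and nz: "\<exists>i\<le>m. x i \<noteq> 0"
  shows "0 < qform (Suc m) (cycle_entry m (t - 1 / m + 1) u z) x"
proof -
  define X where "X = cycle_lift u x"
  define \<zeta> where "\<zeta> = z * cnj u + 1 / of_nat m"
  define S where "S = (\<Sum>i<m. (cmod (X i - X (Suc i)))\<^sup>2)"
  define W where "W = (cmod (X 0))\<^sup>2 + (cmod (X m))\<^sup>2"
  have Q: "qform (Suc m) (cycle_entry m (t - 1 / m + 1) u z) x
      = S + (t - 1 / m) * W - 2 * Re (z * cnj u * X 0 * cnj (X m))"
    unfolding qform_cycle_entry[OF m u] X_def[symmetric] S_def W_def by simp
  have ef: "(cmod (X 0 - X m))\<^sup>2 / m + (t - 1 / m) * W - 2 * Re (z * cnj u * X 0 * cnj (X m))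
      = t * W - 2 * Re (\<zeta> * X 0 * cnj (X m))"
    unfolding W_def \<zeta>_def by (rule endpoint_form)
  have S_ge: "(cmod (X 0 - X m))\<^sup>2 / m \<le> S" unfolding S_def using m by (intro norm_diff_le_path_energy) auto
  have "2 * Re (\<zeta> * X 0 * cnj (X m)) \<le> 2 * (cmod \<zeta> * (cmod (X 0) * cmod (X m)))"
    using complex_Re_le_cmod[of "\<zeta> * X 0 * cnj (X m)"] by (simp add: norm_mult)
  also have "\<dots> = cmod \<zeta> * (2 * cmod (X 0) * cmod (X m))" by simp
  also have "\<dots> \<le> cmod \<zeta> * W"
    unfolding W_def by (intro mult_left_mono sum_squares_bound) auto
  finally have R: "2 * Re (\<zeta> * X 0 * cnj (X m)) \<le> cmod \<zeta> * W" .
  have tz: "cmod \<zeta> < t" using t by (simp add: \<zeta>_def)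
  have W0: "0 \<le> W" by (simp add: W_def)
  show ?thesis
  proof (cases "W = 0")
    case False
    then have "cmod \<zeta> * W < t * W" using W0 tz by simp
    then show ?thesis using Q ef S_ge R by linarith
  next
    case True
    then have ends: "X 0 = 0" "X m = 0" by (simp_all add: W_def add_nonneg_eq_0_iff)
    have S0: "0 \<le> S" unfolding S_def by (intro sum_nonneg) auto
    \<comment> \<open>Both ends vanish here; zero energy would make the lifted vector constant,
      hence zero, and the lift loses nothing as u is a unit.\<close>
    have "S \<noteq> 0"
    proof
      assume "S = 0"
      then have step: "X i = X (Suc i)" if "i < m" for i
        using that unfolding S_def by (subst (asm) sum_nonneg_eq_0_iff) auto
      have X0: "X i = 0" if "i \<le> m" for i
        using that by (induction i) (use ends step in \<open>auto simp: less_Suc_eq_le\<close>)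
      have "x i = 0" if "i \<le> m" for i
        using X0[OF that] u by (auto simp: X_def cycle_lift_def split: if_splits)
      then show False using nz by auto
    qed
    then show ?thesis using Q True S0 ends by simp
  qed
qed

text \<open>Linear interpolation between the ends gives equality in the path energy bound. The end
  values cnj \<zeta> and |\<zeta>| align the phase of the cross term, and the form becomes 2
  |\<zeta>|^2 (t - |\<zeta>|).\<close>

lemma qform_cycle_entry_neg:
  assumes m: "2 \<le> m" and u: "cmod u = 1" and t: "t < cmod (z * cnj u + 1 / of_nat m)" "0 \<le> t"
  shows "\<exists>x. qform (Suc m) (cycle_entry m (t - 1 / m + 1) u z) x < 0"
proof -
  define \<zeta> where "\<zeta> = z * cnj u + 1 / of_nat m"
  define a where "a = cnj \<zeta>"
  define b where "b = complex_of_real (cmod \<zeta>)"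
  define h where "h = (b - a) / of_nat m"
  define X where "X i = a + of_nat i * h" for i
  \<comment> \<open>The factor - cnj u at vertex 0 undoes the lift.\<close>
  define x where "x i = (if i = 0 then - cnj u * a else X i)" for i
  have m0: "(of_nat m :: complex) \<noteq> 0" using m by simp
  have uu: "u * cnj u = 1" using u by (simp add: complex_norm_square[symmetric])
  have lift: "cycle_lift u x = X"
    using uu by (auto simp: cycle_lift_def x_def X_def fun_eq_iff mult.assoc[symmetric])
  have X: "X 0 = a" "X m = b" using m0 by (simp_all add: X_def h_def)
  have "X i - X (Suc i) = - h" for i
    by (simp add: X_def algebra_simps)
  then have "(\<Sum>i<m. (cmod (X i - X (Suc i)))\<^sup>2) = m * (cmod (a - b) / m)\<^sup>2"
    by (simp add: h_def norm_divide norm_minus_commute)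
  also have "\<dots> = (cmod (a - b))\<^sup>2 / m" using m by (simp add: power_divide power2_eq_square)
  finally have "qform (Suc m) (cycle_entry m (t - 1 / m + 1) u z) x
      = (cmod (a - b))\<^sup>2 / m + (t - 1 / m) * ((cmod a)\<^sup>2 + (cmod b)\<^sup>2) - 2 * Re (z * cnj u * a * cnj b)"
    unfolding qform_cycle_entry[OF m u] lift X by simp
  also have "\<dots> = t * ((cmod a)\<^sup>2 + (cmod b)\<^sup>2) - 2 * Re (\<zeta> * a * cnj b)"
    unfolding \<zeta>_def by (rule endpoint_form)
  also have "\<zeta> * a * cnj b = of_real ((cmod \<zeta>)\<^sup>2 * cmod \<zeta>)"
    by (simp add: a_def b_def complex_norm_square[symmetric])
  also have "t * ((cmod a)\<^sup>2 + (cmod b)\<^sup>2) - 2 * Re (of_real ((cmod \<zeta>)\<^sup>2 * cmod \<zeta>))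
      = 2 * (cmod \<zeta>)\<^sup>2 * (t - cmod \<zeta>)"
    by (simp add: a_def b_def algebra_simps)
  also have "\<dots> < 0"
    using t by (intro mult_pos_neg) (auto simp: \<zeta>_def)
  finally show ?thesis by blast
qed

text \<open>The cycle block transported along the vertex sequence \<open>c\<close>, plus an identity
  block on all other vertices, so that definiteness is decided on the cycle.\<close>

definition cycle_mat :: "(nat \<Rightarrow> nat) \<Rightarrow> nat \<Rightarrow> real \<Rightarrow> complex \<Rightarrow> complex \<Rightarrow> nat \<Rightarrow> nat \<Rightarrow> complex" where
  "cycle_mat c m d u z p q =
    (if p \<in> c ` {..m} \<and> q \<in> c ` {..m}
     then cycle_entry m d u z (inv_into {..m} c p) (inv_into {..m} c q)
     else if p = q then 1 else 0)"

lemma herm_on_cycle_mat: "herm_on n (cycle_mat c m d u z)"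
proof -
  have [intro]: "cycle_entry m d u z j i = cnj (cycle_entry m d u z i j)" for i j
    by (rule herm_onD[OF herm_on_cycle_entry, of _ "Suc (max i j)"]) auto
  show ?thesis unfolding herm_on_def by (auto simp: cycle_mat_def)
qed

lemma qform_cycle_mat:
  assumes inj: "inj_on c {..m}" and sub: "c ` {..m} \<subseteq> {..<n}"
  shows "qform n (cycle_mat c m d u z) v
    = qform (Suc m) (cycle_entry m d u z) (v \<circ> c) + (\<Sum>p\<in>{..<n} - c ` {..m}. (cmod (v p))\<^sup>2)"
proof -
  let ?U = "c ` {..m}" and ?a = "cycle_mat c m d u z"
  let ?t = "\<lambda>p q. Re (cnj (v p) * ?a p q * v q)"
  have inU: "(\<Sum>q<n. ?t p q) = (\<Sum>q\<in>?U. ?t p q)" if "p \<in> ?U" for p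
    using that sub by (intro sum.mono_neutral_right) (auto simp: cycle_mat_def)
  have outU: "(\<Sum>q<n. ?t p q) = (cmod (v p))\<^sup>2" if "p \<in> {..<n} - ?U" for p
  proof -
    have "(\<Sum>q<n. ?t p q) = (\<Sum>q\<in>{p}. ?t p q)"
      using that by (intro sum.mono_neutral_right) (auto simp: cycle_mat_def)
    then show ?thesis
      unfolding cmod_power2 using that by (simp add: cycle_mat_def power2_eq_square)
  qed
  have "qform n ?a v = (\<Sum>p\<in>?U. \<Sum>q<n. ?t p q) + (\<Sum>p\<in>{..<n} - ?U. \<Sum>q<n. ?t p q)"
    unfolding qform_def using sum.subset_diff[OF sub] by (simp add: add.commute)
  also have "\<dots> = (\<Sum>p\<in>?U. \<Sum>q\<in>?U. ?t p q) + (\<Sum>p\<in>{..<n} - ?U. (cmod (v p))\<^sup>2)"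
    by (simp only: sum.cong[OF refl inU] sum.cong[OF refl outU])
  also have "(\<Sum>p\<in>?U. \<Sum>q\<in>?U. ?t p q) = qform (Suc m) (cycle_entry m d u z) (v \<circ> c)"
    unfolding qform_def sum.reindex[OF inj] lessThan_Suc_atMost
    using inj by (intro sum.cong) (auto simp: cycle_mat_def inv_into_f_f)
  finally show ?thesis .
qed

lemma pd_on_cycle_mat:
  assumes inj: "inj_on c {..m}" and sub: "c ` {..m} \<subseteq> {..<n}"
    and m: "2 \<le> m" and u: "cmod u = 1" and t: "cmod (z * cnj u + 1 / of_nat m) < t"
  shows "pd_on n (cycle_mat c m (t - 1 / m + 1) u z)"
  unfolding pd_on_def
proof (intro conjI herm_on_cycle_mat allI impI)
  fix v :: "nat \<Rightarrow> complex"
  assume "\<exists>i<n. v i \<noteq> 0"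
  then obtain p where p: "p < n" "v p \<noteq> 0" by blast
  let ?Q = "qform (Suc m) (cycle_entry m (t - 1 / m + 1) u z) (v \<circ> c)"
  let ?R = "\<Sum>p\<in>{..<n} - c ` {..m}. (cmod (v p))\<^sup>2"
  have pos: "0 < ?Q" if "\<exists>i\<le>m. (v \<circ> c) i \<noteq> 0" using qform_cycle_entry_pos[OF m u t that] .
  have "?Q = 0" if "\<not> (\<exists>i\<le>m. (v \<circ> c) i \<noteq> 0)"
    using that by (simp add: qform_def less_Suc_eq_le)
  with pos have Q0: "0 \<le> ?Q" by (metis less_imp_le order_refl)
  have R0: "0 \<le> ?R" by (intro sum_nonneg) auto
  have "0 < ?Q + ?R"
  proof (cases "p \<in> c ` {..m}")
    case True
    then show ?thesis using pos p R0 by force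
  next
    case False
    then have "0 < ?R" using p by (intro sum_pos2[of _ p]) auto
    then show ?thesis using Q0 by linarith
  qed
  then show "0 < qform n (cycle_mat c m (t - 1 / m + 1) u z) v"
    by (simp add: qform_cycle_mat[OF inj sub])
qed

lemma not_psd_on_cycle_mat:
  assumes inj: "inj_on c {..m}" and sub: "c ` {..m} \<subseteq> {..<n}"
    and m: "2 \<le> m" and u: "cmod u = 1" and t: "t < cmod (z * cnj u + 1 / of_nat m)" "0 \<le> t"
  shows "\<exists>v. qform n (cycle_mat c m (t - 1 / m + 1) u z) v < 0"
proof -
  obtain x where x: "qform (Suc m) (cycle_entry m (t - 1 / m + 1) u z) x < 0"
    using qform_cycle_entry_neg[OF m u t] by blast
  define v where "v p = (if p \<in> c ` {..m} then x (inv_into {..m} c p) else 0)" for p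
  have "(\<Sum>p\<in>{..<n} - c ` {..m}. (cmod (v p))\<^sup>2) = 0"
    by (intro sum.neutral) (auto simp: v_def)
  moreover have "qform (Suc m) (cycle_entry m (t - 1 / m + 1) u z) (v \<circ> c)
      = qform (Suc m) (cycle_entry m (t - 1 / m + 1) u z) x"
    unfolding qform_def using inj by (intro sum.cong) (auto simp: v_def inv_into_f_f)
  ultimately show ?thesis using x qform_cycle_mat[OF inj sub] by (metis add.right_neutral)
qed

section \<open>Positive scaling, zero pattern and rigidity on a cycle\<close>

lemma qform_scale: "qform n (\<lambda>i j. of_real \<alpha> * a i j) v = \<alpha> * qform n a v"
proof -
  have "Re (cnj (v i) * (of_real \<alpha> * a i j) * v j) = \<alpha> * Re (cnj (v i) * a i j * v j)" for i j
  proof -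
    have "cnj (v i) * (of_real \<alpha> * a i j) * v j = of_real \<alpha> * (cnj (v i) * a i j * v j)"
      by (simp only: mult_ac)
    then show ?thesis by (simp only: Re_complex_of_real Im_complex_of_real times_complex.sel mult_zero_left diff_zero)
  qed
  then show ?thesis unfolding qform_def by (simp only: sum_distrib_left)
qed

lemma herm_on_scale: "\<alpha> \<noteq> 0 \<Longrightarrow> herm_on n (\<lambda>i j. of_real \<alpha> * a i j) \<longleftrightarrow> herm_on n a"
  by (simp add: herm_on_def)

lemma pd_on_scale: "0 < \<alpha> \<Longrightarrow> pd_on n (\<lambda>i j. of_real \<alpha> * a i j) \<longleftrightarrow> pd_on n a"
  by (simp add: pd_on_def herm_on_scale qform_scale zero_less_mult_iff)

lemma psd_on_scale: "0 < \<alpha> \<Longrightarrow> psd_on n (\<lambda>i j. of_real \<alpha> * a i j) \<longleftrightarrow> psd_on n a"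
  by (simp add: psd_on_def herm_on_scale qform_scale zero_le_mult_iff)

lemma restr_mult: "restr E (\<lambda>i j. k * a i j) = (\<lambda>i j. k * restr E a i j)"
  by (simp add: restr_def fun_eq_iff)

text \<open>Nonzero off-diagonal entries occur only between consecutive vertices or at the closing
  pair, which are edges; chords already carry 0.\<close>

lemma restr_cycle_mat:
  assumes E: "symp E" and inj: "inj_on c {..m}"
    and step: "\<And>i. i < m \<Longrightarrow> E (c i) (c (Suc i))" and close: "E (c m) (c 0)"
  shows "restr E (cycle_mat c m d u z) = cycle_mat c m d u z"
proof (intro ext)
  fix p q
  have "cycle_mat c m d u z p q = 0" if no: "p \<noteq> q" "\<not> E p q"
  proof (cases "p \<in> c ` {..m} \<and> q \<in> c ` {..m}")
    case True
    then obtain i j where ij: "i \<le> m" "j \<le> m" "p = c i" "q = c j" by auto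
    have nE: "\<not> E (c i) (c j)" "\<not> E (c j) (c i)" using no ij sympD[OF E] by auto
    have "i \<noteq> j" using no ij by auto
    moreover have "j \<noteq> Suc i" "i \<noteq> Suc j" using nE ij step[of i] step[of j] by auto
    moreover have "\<not> (i = m \<and> j = 0)" "\<not> (i = 0 \<and> j = m)" using nE close by blast+
    ultimately
    show ?thesis using ij inj by (auto simp: cycle_mat_def inv_into_f_f cycle_entry_def)
  next
    case False
    then show ?thesis using no unfolding cycle_mat_def by (simp only: if_False)
  qed
  then show "restr E (cycle_mat c m d u z) p q = cycle_mat c m d u z p q"
    by (simp add: restr_def)
qed

text \<open>\<phi> = f / \<alpha> fixes the reals, preserves moduli and commutes with conjugation.
  So the image of a cycle matrix with parameters u, z is \<alpha> times the one with parameters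
  \<phi>(u), \<phi>(z), and the same criterion applies to both. Zeros are available since \<Omega>
  is the whole plane.\<close>

lemma (in definiteness_preserver) f_rigid_of_cycle:
  assumes UNIV: "\<Omega> = UNIV"
    and inj: "inj_on c {..m}" and sub: "c ` {..m} \<subseteq> {..<n}" and m: "2 \<le> m"
    and step: "\<And>i. i < m \<Longrightarrow> E (c i) (c (Suc i))" and close: "E (c m) (c 0)"
  shows "(\<forall>z. f z = of_real (g 1) * z) \<or> (\<forall>z. f z = of_real (g 1) * cnj z)"
proof -
  define \<alpha> where "\<alpha> = g 1"
  define \<phi> where "\<phi> z = f z / of_real \<alpha>" for z
  have \<alpha>: "0 < \<alpha>" using g_pos[of 1] by (simp add: \<alpha>_def)
  have f: "f z = of_real \<alpha> * \<phi> z" for z using \<alpha> by (simp add: \<phi>_def)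
  have \<phi>_cnj: "\<phi> (cnj z) = cnj (\<phi> z)" for z using f_edge(1)[of z] by (simp add: UNIV \<phi>_def)
  have \<phi>_norm: "cmod (\<phi> z) = cmod z" for z
    using f_edge(2)[of z] \<alpha> by (simp add: UNIV \<phi>_def norm_divide \<alpha>_def)
  have \<phi>_real: "\<phi> (of_real x) = of_real x" for x
    using f_real[of x] \<alpha> by (simp add: UNIV \<phi>_def \<alpha>_def)
  have \<phi>_num: "\<phi> 0 = 0" "\<phi> 1 = 1" "\<phi> 2 = 2" "\<phi> (- 1) = - 1"
    using \<phi>_real[of 0] \<phi>_real[of 1] \<phi>_real[of 2] \<phi>_real[of "- 1"] by simp_all
  have image: "f (cycle_mat c m d u z p q) = of_real \<alpha> * cycle_mat c m d (\<phi> u) (\<phi> z) p q" for d u z p q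
    unfolding f cycle_mat_def cycle_entry_def if_distrib[of \<phi>] \<phi>_num \<phi>_real \<phi>_cnj ..
  have rc: "restr E (cycle_mat c m d u z) = cycle_mat c m d u z" for d u z
    by (rule restr_cycle_mat[OF E_sym inj step close])
  have pres: "P (cycle_mat c m d u z) \<longleftrightarrow> P (\<lambda>i j. of_real \<alpha> * cycle_mat c m d (\<phi> u) (\<phi> z) i j)" for d u z
    using preserves[OF herm_on_cycle_mat, of c m d u z] UNIV by (simp add: image restr_mult rc)
  have not_psd: "\<not> psd_on n (cycle_mat c m (t - 1 / m + 1) u z)"
    if "cmod u = 1" "t < cmod (z * cnj u + 1 / of_nat m)" "0 \<le> t" for t u z
    using not_psd_on_cycle_mat[OF inj sub m that] by (auto simp: psd_on_def not_le)
  \<comment> \<open>A value t strictly between the two moduli would make one of the two matrices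
    definite and the other not even semidefinite.\<close>
  have modulus: "cmod (z * cnj u + 1 / of_nat m) = cmod (\<phi> z * cnj (\<phi> u) + 1 / of_nat m)"
    (is "?l = ?r") if u: "cmod u = 1" for z u
  proof (rule ccontr)
    have u': "cmod (\<phi> u) = 1" using u \<phi>_norm by simp
    assume "?l \<noteq> ?r"
    then consider "?l < ?r" | "?r < ?l" by linarith
    then show False
    proof cases
      case 1
      then obtain t where t: "?l < t" "t < ?r" using dense by blast
      then have "0 \<le> t" using norm_ge_zero[of "z * cnj u + 1 / of_nat m"] by linarith
      have "P (cycle_mat c m (t - 1 / m + 1) u z)"
        using pd_imp[OF pd_on_cycle_mat[OF inj sub m u t(1)]] .
      then have "psd_on n (cycle_mat c m (t - 1 / m + 1) (\<phi> u) (\<phi> z))"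
        using imp_psd pres psd_on_scale[OF \<alpha>] by blast
      then show False using not_psd[OF u' t(2) \<open>0 \<le> t\<close>] by blast
    next
      case 2
      then obtain t where t: "?r < t" "t < ?l" using dense by blast
      then have "0 \<le> t" using norm_ge_zero[of "\<phi> z * cnj (\<phi> u) + 1 / of_nat m"] by linarith
      have "pd_on n (cycle_mat c m (t - 1 / m + 1) (\<phi> u) (\<phi> z))"
        by (rule pd_on_cycle_mat[OF inj sub m u' t(1)])
      then have "P (\<lambda>i j. of_real \<alpha> * cycle_mat c m (t - 1 / m + 1) (\<phi> u) (\<phi> z) i j)"
        using pd_imp pd_on_scale[OF \<alpha>] by blast
      then have "psd_on n (cycle_mat c m (t - 1 / m + 1) u z)"
        using imp_psd pres by blast
      then show False using not_psd[OF u t(2) \<open>0 \<le> t\<close>] by blast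
    qed
  qed
  have Re_eq: "Re (z * cnj u) = Re (\<phi> z * cnj (\<phi> u))" if u: "cmod u = 1" for z u
  proof -
    \<comment> \<open>Since |w|^2 is already preserved, the cross term 2 Re(w) / m is the only new
      information.\<close>
    have exp: "(cmod (w + 1 / of_nat m))\<^sup>2 = (cmod w)\<^sup>2 + 2 * Re w / m + (1 / m)\<^sup>2" for w
    proof -
      have "1 / of_nat m = complex_of_real (1 / m)" by simp
      then show ?thesis unfolding cmod_power2
        by (simp only: plus_complex.sel Re_complex_of_real Im_complex_of_real) (simp add: power2_sum)
    qed
    have "(cmod (z * cnj u))\<^sup>2 = (cmod (\<phi> z * cnj (\<phi> u)))\<^sup>2" by (simp add: norm_mult \<phi>_norm)
    moreover have "(cmod (z * cnj u + 1 / of_nat m))\<^sup>2 = (cmod (\<phi> z * cnj (\<phi> u) + 1 / of_nat m))\<^sup>2"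
      using modulus[OF u] by simp
    ultimately have "2 * Re (z * cnj u) / m = 2 * Re (\<phi> z * cnj (\<phi> u)) / m"
      unfolding exp by linarith
    then show ?thesis using m by (simp only: divide_cancel_right mult_cancel_left) auto
  qed
  have Re: "Re (\<phi> z) = Re z" for z
    using Re_eq[of "- 1" z] \<phi>_num by simp
  have "(cmod (\<phi> \<i>))\<^sup>2 = 1" using \<phi>_norm[of \<i>] by simp
  \<comment> \<open>The real part of \<phi>(\<i>) is 0, so \<phi>(\<i>) is \<i> or -\<i>; this
    single sign decides the alternative for all z.\<close>
  then consider "Im (\<phi> \<i>) = 1" | "Im (\<phi> \<i>) = - 1"
    unfolding cmod_power2 using Re[of \<i>] by (auto simp: power2_eq_1_iff)
  then show ?thesis
  proof cases
    case 1
    have "Im (\<phi> z) = Im z" for z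
      using Re_eq[of \<i> z] Re[of \<i>] 1 by simp
    with Re have "\<phi> z = z" for z by (simp only: complex_eq_iff)
    then show ?thesis by (simp add: f \<alpha>_def)
  next
    case 2
    have "Im (\<phi> z) = - Im z" for z
      using Re_eq[of \<i> z] Re[of \<i>] 2 by simp
    with Re have "\<phi> z = cnj z" for z by (simp only: complex_eq_iff cnj.sel)
    then show ?thesis by (simp add: f \<alpha>_def)
  qed
qed

section \<open>Forests\<close>

text \<open>\<open>m\<close> is the index of the last vertex, so a cycle has m + 1 \<ge> 3 vertices
  and an edge run back and forth does not count.\<close>

definition cycle_fun :: "('a \<Rightarrow> 'a \<Rightarrow> bool) \<Rightarrow> nat \<Rightarrow> (nat \<Rightarrow> 'a) \<Rightarrow> bool" where
  "cycle_fun E m c \<longleftrightarrow> 2 \<le> m \<and> inj_on c {..m} \<and> (\<forall>i<m. E (c i) (c (Suc i))) \<and> E (c m) (c 0)"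

text \<open>The first vertex of a longest path is a leaf, since a second neighbour would close a cycle.\<close>

lemma exists_leaf:
  assumes fin: "finite S" and ne: "S \<noteq> {}" and E: "symp E"
    and irrefl: "\<And>i. \<not> E i i"
    and acyclic: "\<And>m c. c ` {..m} \<subseteq> S \<Longrightarrow> \<not> cycle_fun E m c"
  obtains s t where "s \<in> S" "\<And>j. j \<in> S \<Longrightarrow> E s j \<Longrightarrow> j = t"
proof -
  define path where "path xs \<longleftrightarrow> xs \<noteq> [] \<and> distinct xs \<and> set xs \<subseteq> S \<and>
    (\<forall>i. Suc i < length xs \<longrightarrow> E (xs ! i) (xs ! Suc i))" for xs
  obtain s0 where "s0 \<in> S" using ne by blast
  then have "path [s0]" by (simp add: path_def)
  moreover have "\<forall>xs. path xs \<longrightarrow> length xs < Suc (card S)"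
  proof (intro allI impI)
    fix xs assume "path xs"
    then have "distinct xs" "set xs \<subseteq> S" unfolding path_def by blast+
    then show "length xs < Suc (card S)" using card_mono[OF fin, of "set xs"] distinct_card[of xs] by simp
  qed
  ultimately have "\<exists>xs. path xs \<and> (\<forall>ys. path ys \<longrightarrow> length ys \<le> length xs)"
    by (rule ex_has_greatest_nat)
  then obtain xs where xs: "path xs" and longest: "\<And>ys. path ys \<Longrightarrow> length ys \<le> length xs"
    by blast
  have xs_facts: "xs \<noteq> []" "distinct xs" "set xs \<subseteq> S"
    "\<And>i. Suc i < length xs \<Longrightarrow> E (xs ! i) (xs ! Suc i)"
    using xs unfolding path_def by blast+
  show thesis
  \<comment> \<open>For a path with a single vertex \<open>xs ! 1\<close> is unspecified, but then
    \<open>xs ! 0\<close> has no neighbour in \<open>S\<close> and the claim is vacuous.\<close>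
  proof (rule that[of "xs ! 0" "xs ! 1"])
    show "xs ! 0 \<in> S" using xs_facts nth_mem[of 0 xs] by auto
    fix j assume j: "j \<in> S" "E (xs ! 0) j"
    have "j \<in> set xs"
    proof (rule ccontr)
      assume "j \<notin> set xs"
      moreover have "E ((j # xs) ! i) ((j # xs) ! Suc i)" if "Suc i < length (j # xs)" for i
        using that xs_facts(4) sympD[OF E j(2)] by (cases i) auto
      ultimately have "path (j # xs)" using xs_facts j by (auto simp: path_def)
      then show False using longest[of "j # xs"] by simp
    qed
    then obtain k where k: "k < length xs" "xs ! k = j" by (auto simp: in_set_conv_nth)
    have "k \<noteq> 0" using k j irrefl by (metis)
    moreover have "\<not> 2 \<le> k"
    proof
      assume "2 \<le> k"
      moreover have "inj_on (\<lambda>i. xs ! i) {..k}"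
        using xs_facts(2) k by (auto intro!: inj_on_nth)
      moreover have "\<forall>i<k. E (xs ! i) (xs ! Suc i)" using xs_facts(4) k by auto
      moreover have "E (xs ! k) (xs ! 0)" using sympD[OF E j(2)] k by simp
      ultimately have "cycle_fun E k (\<lambda>i. xs ! i)" by (simp add: cycle_fun_def)
      moreover have "(\<lambda>i. xs ! i) ` {..k} \<subseteq> S" using k xs_facts(3) by (auto intro!: subsetD[OF xs_facts(3)])
      ultimately show False using acyclic by blast
    qed
    ultimately have "k = 1" by simp
    then show "j = xs ! 1" using k by simp
  qed
qed

text \<open>Cycles are the only obstruction to writing unit edge weights as quotients of vertex
  phases. Induction removes a leaf, whose phase enters a single edge condition and can be solved
  for.\<close>

lemma forest_gauge:
  fixes \<kappa> :: "'a \<Rightarrow> 'a \<Rightarrow> complex"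
  assumes "finite S" and E: "symp E" and irrefl: "\<And>i. \<not> E i i"
    and "\<And>m c. c ` {..m} \<subseteq> S \<Longrightarrow> \<not> cycle_fun E m c"
    and unit: "\<And>i j. i \<in> S \<Longrightarrow> j \<in> S \<Longrightarrow> E i j \<Longrightarrow> cmod (\<kappa> i j) = 1"
    and herm: "\<And>i j. i \<in> S \<Longrightarrow> j \<in> S \<Longrightarrow> E i j \<Longrightarrow> \<kappa> j i = cnj (\<kappa> i j)"
  shows "\<exists>\<theta>. (\<forall>i. cmod (\<theta> i) = 1) \<and> (\<forall>i\<in>S. \<forall>j\<in>S. E i j \<longrightarrow> \<kappa> i j = \<theta> i * cnj (\<theta> j))"
  using assms
proof (induction "card S" arbitrary: S)
  case 0
  then have "S = {}" by simp
  then show ?case by (auto intro!: exI[of _ "\<lambda>_. 1"])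
next
  case (Suc k)
  then have "S \<noteq> {}" by auto
  then obtain s t where s: "s \<in> S" and t: "\<And>j. j \<in> S \<Longrightarrow> E s j \<Longrightarrow> j = t"
    using exists_leaf[OF Suc.prems(1) _ E irrefl Suc.prems(4)] by blast
  have "\<exists>\<theta>. (\<forall>i. cmod (\<theta> i) = 1) \<and> (\<forall>i\<in>S - {s}. \<forall>j\<in>S - {s}. E i j \<longrightarrow> \<kappa> i j = \<theta> i * cnj (\<theta> j))"
  proof (rule Suc.hyps(1))
    show "k = card (S - {s})" using Suc.hyps(2) s Suc.prems(1) by simp
    show "\<not> cycle_fun E m c" if "c ` {..m} \<subseteq> S - {s}" for m c
      using Suc.prems(4)[of c m] that by blast
  qed (use Suc.prems in auto)
  then obtain \<theta> where norm: "\<And>i. cmod (\<theta> i) = 1"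
    and \<theta>: "\<And>i j. i \<in> S - {s} \<Longrightarrow> j \<in> S - {s} \<Longrightarrow> E i j \<Longrightarrow> \<kappa> i j = \<theta> i * cnj (\<theta> j)"
    by blast
  \<comment> \<open>The edge to \<open>t\<close> dictates the phase at the leaf; an isolated vertex
    gets 1.\<close>
  define \<theta>' where "\<theta>' = \<theta>(s := if t \<in> S \<and> E s t then \<kappa> s t * \<theta> t else 1)"
  have norm': "cmod (\<theta>' i) = 1" for i
    using norm Suc.prems(5)[OF s] by (simp add: \<theta>'_def norm_mult)
  have leaf: "\<kappa> s j = \<theta>' s * cnj (\<theta>' j)" if j: "j \<in> S" "E s j" for j
  proof -
    have "j = t" using t j by blast
    moreover have "j \<noteq> s" using j irrefl by auto
    moreover have "\<theta> j * cnj (\<theta> j) = 1"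
      using norm[of j] by (simp add: complex_norm_square[symmetric])
    ultimately show ?thesis using j by (simp add: \<theta>'_def mult.assoc)
  qed
  have "\<kappa> i j = \<theta>' i * cnj (\<theta>' j)" if ij: "i \<in> S" "j \<in> S" "E i j" for i j
  proof -
    consider "i = s" | "i \<noteq> s" "j = s" | "i \<noteq> s" "j \<noteq> s" by blast
    then show ?thesis
    proof cases
      case 1
      then show ?thesis using leaf ij by simp
    next
      case 2
      then have "E s i" using sympD[OF E ij(3)] by simp
      then have "cnj (\<kappa> s i) = \<theta>' i * cnj (\<theta>' s)" using leaf[OF ij(1)] by (simp add: mult.commute)
      then show ?thesis using 2 Suc.prems(6)[OF s ij(1) \<open>E s i\<close>] by simp
    next
      case 3
      then show ?thesis using \<theta> ij by (simp add: \<theta>'_def)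
    qed
  qed
  then show ?case using norm' by blast
qed

text \<open>\<open>T\<close> is an arbitrary substitution of vectors, not a linear one, so that
  complex conjugation is covered as well as multiplication by phases.\<close>

lemma definiteness_transfer:
  assumes herm: "herm_on n a" "herm_on n b" and \<alpha>: "0 < \<alpha>"
    and form: "\<And>v. qform n b v = \<alpha> * qform n a (T v)"
    and zero: "\<And>v i. i < n \<Longrightarrow> T v i = 0 \<longleftrightarrow> v i = 0"
    and surj: "\<And>w. \<exists>v. T v = w"
  shows "pd_on n b \<longleftrightarrow> pd_on n a" and "psd_on n b \<longleftrightarrow> psd_on n a"
proof -
  have nz: "(\<exists>i<n. T v i \<noteq> 0) \<longleftrightarrow> (\<exists>i<n. v i \<noteq> 0)" for v using zero by blast
  have all: "(\<forall>w. Q w) \<longleftrightarrow> (\<forall>v. Q (T v))" for Q using surj by metis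
  show "pd_on n b \<longleftrightarrow> pd_on n a"
    unfolding pd_on_def all[of "\<lambda>w. (\<exists>i<n. w i \<noteq> 0) \<longrightarrow> 0 < qform n a w"] nz form
    using herm \<alpha> by (simp add: zero_less_mult_iff)
  show "psd_on n b \<longleftrightarrow> psd_on n a"
    unfolding psd_on_def all[of "\<lambda>w. 0 \<le> qform n a w"] form
    using herm \<alpha> by (simp add: zero_le_mult_iff)
qed

text \<open>\<open>b\<close> is \<alpha> times the conjugate of \<open>a\<close> by the diagonal
  unitary matrix of the \<theta> i; the substitution applies the adjoint of that matrix to the
  vector.\<close>

lemma definiteness_gauge:
  assumes herm: "herm_on n a" and \<alpha>: "0 < \<alpha>" and \<theta>: "\<And>i. cmod (\<theta> i) = 1"
    and b: "\<And>i j. i < n \<Longrightarrow> j < n \<Longrightarrow> b i j = of_real \<alpha> * (\<theta> i * cnj (\<theta> j)) * a i j"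
  shows "(pd_on n b \<longleftrightarrow> pd_on n a) \<and> (psd_on n b \<longleftrightarrow> psd_on n a)"
proof -
  have hb: "herm_on n b"
    unfolding herm_on_def
  proof (intro allI impI)
    fix i j assume ij: "i < n" "j < n"
    show "b j i = cnj (b i j)"
      unfolding b[OF ij] b[OF ij(2,1)] herm_onD[OF herm ij] by simp
  qed
  have form: "qform n b v = \<alpha> * qform n a (\<lambda>i. cnj (\<theta> i) * v i)" for v
    unfolding qform_def sum_distrib_left
  proof (intro sum.cong refl)
    fix i j assume "i \<in> {..<n}" "j \<in> {..<n}"
    then have "cnj (v i) * b i j * v j = of_real \<alpha> * (cnj (cnj (\<theta> i) * v i) * a i j * (cnj (\<theta> j) * v j))"
      using b[of i j] by (simp add: mult_ac)
    then show "Re (cnj (v i) * b i j * v j) = \<alpha> * Re (cnj (cnj (\<theta> i) * v i) * a i j * (cnj (\<theta> j) * v j))"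
      by (simp only: Re_complex_of_real Im_complex_of_real times_complex.sel(1)[of "of_real \<alpha>"] mult_zero_left diff_zero)
  qed
  have unit: "cnj (\<theta> i) * \<theta> i = 1" for i
    using \<theta>[of i] by (simp add: complex_norm_square[symmetric] mult.commute)
  have nz: "\<theta> i \<noteq> 0" for i using unit[of i] by auto
  have surj: "\<exists>v. (\<lambda>i. cnj (\<theta> i) * v i) = w" for w :: "nat \<Rightarrow> complex"
    by (rule exI[of _ "\<lambda>i. \<theta> i * w i"]) (simp add: mult.assoc[symmetric] unit)
  show ?thesis
    using definiteness_transfer[OF herm hb \<alpha> form _ surj] nz by simp
qed

text \<open>Conjugating vector and matrix together conjugates every term of the form, which leaves
  the real parts unchanged.\<close>

lemma definiteness_cnj:
  assumes herm: "herm_on n a" and \<alpha>: "0 < \<alpha>"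
    and b: "\<And>i j. i < n \<Longrightarrow> j < n \<Longrightarrow> b i j = of_real \<alpha> * cnj (a i j)"
  shows "(pd_on n b \<longleftrightarrow> pd_on n a) \<and> (psd_on n b \<longleftrightarrow> psd_on n a)"
proof -
  have hb: "herm_on n b"
    unfolding herm_on_def
  proof (intro allI impI)
    fix i j assume ij: "i < n" "j < n"
    show "b j i = cnj (b i j)"
      unfolding b[OF ij] b[OF ij(2,1)] herm_onD[OF herm ij] by simp
  qed
  have form: "qform n b v = \<alpha> * qform n a (\<lambda>i. cnj (v i))" for v
    unfolding qform_def sum_distrib_left
  proof (intro sum.cong refl)
    fix i j assume "i \<in> {..<n}" "j \<in> {..<n}"
    then have "cnj (v i) * b i j * v j = of_real \<alpha> * cnj (cnj (cnj (v i)) * a i j * cnj (v j))"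
      using b[of i j] by (simp add: mult_ac)
    then show "Re (cnj (v i) * b i j * v j) = \<alpha> * Re (cnj (cnj (v i)) * a i j * cnj (v j))"
      by (simp only: Re_complex_of_real Im_complex_of_real times_complex.sel(1)[of "of_real \<alpha>"] mult_zero_left diff_zero cnj.sel(1))
  qed
  have surj: "\<exists>v. (\<lambda>i. cnj (v i)) = w" for w :: "nat \<Rightarrow> complex"
    by (rule exI[of _ "\<lambda>i. cnj (w i)"]) simp
  show ?thesis
    using definiteness_transfer[OF herm hb \<alpha> form _ surj] by simp
qed

section \<open>Graphs and matrices with prescribed zeros\<close>

text \<open>Connectedness of a digraph means reachability in its symmetrisation, hence closure under
  arcs in both directions; the proof is induction along a walk.\<close>

lemma connected_closed_set:
  assumes conn: "Digraph_Component.connected (with_proj G)"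
    and S: "S \<subseteq> pverts G" "u \<in> S"
    and closed: "\<And>x y. x \<in> S \<Longrightarrow> (x, y) \<in> parcs G \<or> (y, x) \<in> parcs G \<Longrightarrow> y \<in> S"
  shows "S = pverts G"
proof
  show "pverts G \<subseteq> S"
  proof
    fix v assume v: "v \<in> pverts G"
    let ?H = "mk_symmetric (with_proj G)"
    have "reachable (with_proj ?H) u v"
      using conn v S unfolding Digraph_Component.connected_def strongly_connected_def by auto
    then have "(u, v) \<in> rtrancl_on (pverts G) (parcs ?H)" by (simp add: reachable_def)
    then show "v \<in> S"
    proof (induction rule: rtrancl_on_induct)
      case (step y z)
      then have "(y, z) \<in> parcs G \<or> (z, y) \<in> parcs G" by (auto simp: parcs_mk_symmetric)
      then show ?case using closed step by blast
    qed (use S in auto)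
  qed
qed (fact S(1))

text \<open>Some edge leaves {0}, say to q, and some edge leaves {0, q}, say to r. The vertex of {0,
  q} adjacent to r is the middle of the path.\<close>

lemma connected_path:
  fixes n :: nat
  assumes conn: "Digraph_Component.connected (with_proj G)" and wf: "pair_wf_digraph G"
    and verts: "pverts G = {0..<n}" and n: "3 \<le> n"
    and E: "symp (\<lambda>i j. (i, j) \<in> parcs G)"
  shows "\<exists>p q r. p < n \<and> q < n \<and> r < n \<and> p \<noteq> q \<and> q \<noteq> r \<and> p \<noteq> r \<and> (p, q) \<in> parcs G \<and> (q, r) \<in> parcs G"
proof -
  have sym: "(j, i) \<in> parcs G" if "(i, j) \<in> parcs G" for i j using sympD[OF E] that by blast
  have lt: "x < n" "y < n" if "(x, y) \<in> parcs G" for x y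
    using pair_wf_digraph.in_arcsD1[OF wf that] pair_wf_digraph.in_arcsD2[OF wf that] verts by auto
  have out: "\<exists>x\<in>S. \<exists>y. y \<notin> S \<and> (x, y) \<in> parcs G" if "S \<subseteq> {0..<n}" "0 \<in> S" "S \<noteq> {0..<n}" for S
  proof (rule ccontr)
    assume no: "\<not> (\<exists>x\<in>S. \<exists>y. y \<notin> S \<and> (x, y) \<in> parcs G)"
    have "S = pverts G"
    proof (rule connected_closed_set[OF conn, of S 0])
      show "y \<in> S" if "x \<in> S" "(x, y) \<in> parcs G \<or> (y, x) \<in> parcs G" for x y
        using no sym that by blast
    qed (use that verts in auto)
    then show False using that verts by simp
  qed
  have "card {0::nat} \<noteq> card {0..<n}" using n by simp
  then have "{0} \<noteq> {0..<n}" by metis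
  then obtain q where q: "q \<noteq> 0" "(0, q) \<in> parcs G"
    using out[of "{0}"] n by auto
  have "card {0, q} \<noteq> card {0..<n}" using n q by simp
  then have "{0, q} \<noteq> {0..<n}" by metis
  then obtain x r where r: "x \<in> {0, q}" "r \<notin> {0, q}" "(x, r) \<in> parcs G"
    using out[of "{0, q}"] n lt[OF q(2)] by auto
  from r(1) consider "x = 0" | "x = q" by blast
  then show ?thesis
  proof cases
    case 1
    then have "(q, 0) \<in> parcs G" "(0, r) \<in> parcs G" "q \<noteq> r" "0 \<noteq> r" using q r sym by auto
    then show ?thesis using lt q(1) by blast
  next
    case 2
    then have "(0, q) \<in> parcs G" "(q, r) \<in> parcs G" "q \<noteq> r" "0 \<noteq> r" using q r by auto
    then show ?thesis using lt q(1) by metis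
  qed
qed

section \<open>Cycles as closed walks and as injective vertex sequences\<close>

lemma pcas_last: "p \<noteq> [] \<Longrightarrow> pcas u p v \<Longrightarrow> snd (last p) = v"
  by (induction p arbitrary: u) (auto split: if_splits)

text \<open>The tail \<open>ys\<close> is general because the path grows at its end, while
  \<open>pcas\<close> recurses from the front.\<close>

lemma pcas_path_append:
  "pcas (c 0) (map (\<lambda>i. (c i, c (Suc i))) [0..<k] @ ys) v \<longleftrightarrow> pcas (c k) ys v"
proof (induction k arbitrary: ys)
  case (Suc k)
  show ?case using Suc.IH[of "(c k, c (Suc k)) # ys"] by simp
qed simp

lemma has_undirected_cycle_iff:
  assumes wf: "pair_wf_digraph G"
  shows "has_undirected_cycle G \<longleftrightarrow> (\<exists>m c. cycle_fun (\<lambda>i j. (i, j) \<in> parcs G) m c)"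
proof
  assume "has_undirected_cycle G"
  then obtain p u where p: "set p \<subseteq> parcs G" "pre_digraph.cas (with_proj G) u p u"
    "distinct (tl (pre_digraph.awalk_verts (with_proj G) u p))" "3 \<le> length p"
    unfolding has_undirected_cycle_def pre_digraph.cycle_def pre_digraph.awalk_def by auto
  have ne: "p \<noteq> []" using p(4) by auto
  define m where "m = length p - 1"
  have m: "2 \<le> m" "length p = Suc m" using p(4) by (auto simp: m_def)
  \<comment> \<open>Vertices are read off as heads of arcs, since distinctness of the walk is stated
    for its vertices after the start. Arc i + 1 then runs from \<open>c i\<close> to
    \<open>c (Suc i)\<close>, and arc 0 is the closing one.\<close>
  define c where "c i = snd (p ! i)" for i
  have v1: "pre_digraph.awalk_verts (with_proj G) u p = map fst p @ [snd (last p)]"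
    using pre_digraph.awalk_verts_conv[of "with_proj G" u p] ne by simp
  have v2: "pre_digraph.awalk_verts (with_proj G) u p = fst (hd p) # map snd p"
    using pre_digraph.awalk_verts_conv'[OF p(2)] ne by simp
  have eq: "map fst p @ [snd (last p)] = fst (hd p) # map snd p" using v1 v2 by simp
  have dist: "distinct (map snd p)" using p(3) v2 by simp
  have step: "(c i, c (Suc i)) \<in> parcs G" if "i < m" for i
  proof -
    have "(map fst p @ [snd (last p)]) ! Suc i = (fst (hd p) # map snd p) ! Suc i"
      using eq by simp
    then have "fst (p ! Suc i) = snd (p ! i)" using that m by (simp add: nth_append)
    then have "p ! Suc i = (c i, c (Suc i))" by (simp add: c_def prod_eq_iff)
    moreover have "p ! Suc i \<in> set p" using that m by simp
    ultimately show ?thesis using p(1) by auto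
  qed
  have "fst (p ! 0) = snd (p ! m)"
  proof -
    have "fst (hd p) = u" using p(2) ne by (cases p) (auto simp: pre_digraph.cas.simps)
    moreover have "snd (last p) = u"
      using pcas_last[OF ne] p(2) unfolding cas_with_proj_eq by blast
    ultimately show ?thesis using ne m by (simp add: hd_conv_nth last_conv_nth)
  qed
  then have "p ! 0 = (c m, c 0)" by (simp add: c_def prod_eq_iff)
  moreover have "p ! 0 \<in> set p" using ne by simp
  ultimately have close: "(c m, c 0) \<in> parcs G" using p(1) by auto
  have "inj_on c {..m}"
    using dist m by (auto simp: inj_on_def c_def distinct_conv_nth less_Suc_eq_le)
  then show "\<exists>m c. cycle_fun (\<lambda>i j. (i, j) \<in> parcs G) m c"
    using m step close unfolding cycle_fun_def by blast
next
  assume "\<exists>m c. cycle_fun (\<lambda>i j. (i, j) \<in> parcs G) m c"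
  then obtain m c where m: "2 \<le> m" and inj: "inj_on c {..m}"
    and step: "\<And>i. i < m \<Longrightarrow> (c i, c (Suc i)) \<in> parcs G" and close: "(c m, c 0) \<in> parcs G"
    unfolding cycle_fun_def by blast
  define p where "p = map (\<lambda>i. (c i, c (Suc i))) [0..<m] @ [(c m, c 0)]"
  have ne: "p \<noteq> []" by (simp add: p_def)
  have "c 0 \<in> pverts G" using pair_wf_digraph.in_arcsD2[OF wf close] .
  moreover have "set p \<subseteq> parcs G" using step close by (auto simp: p_def)
  moreover have "pre_digraph.cas (with_proj G) (c 0) p (c 0)"
    unfolding cas_with_proj_eq p_def pcas_path_append by simp
  \<comment> \<open>The vertex list repeats \<open>c 0\<close> at its end; without the first element
    every vertex occurs once.\<close>
  moreover have "distinct (tl (pre_digraph.awalk_verts (with_proj G) (c 0) p))"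
  proof -
    have "pre_digraph.awalk_verts (with_proj G) (c 0) p = map c [0..<Suc m] @ [c 0]"
      unfolding pre_digraph.awalk_verts_conv using ne by (simp add: p_def)
    moreover have "map c [0..<Suc m] = c 0 # map c [Suc 0..<Suc m]"
      by (simp add: upt_rec[of 0 "Suc m"] del: upt_Suc)
    ultimately have "tl (pre_digraph.awalk_verts (with_proj G) (c 0) p) = map c [Suc 0..<Suc m] @ [c 0]"
      by (simp only: append_Cons list.sel)
    moreover have "inj_on c {Suc 0..<Suc m}" using inj by (rule inj_on_subset) auto
    moreover have "c 0 \<notin> c ` {Suc 0..<Suc m}"
      by (auto simp: inj_on_eq_iff[OF inj])
    ultimately show ?thesis by (simp add: distinct_map del: upt_Suc)
  qed
  ultimately have "pre_digraph.cycle (with_proj G) p"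
    unfolding pre_digraph.cycle_def pre_digraph.awalk_def using ne by auto
  then show "has_undirected_cycle G"
    unfolding has_undirected_cycle_def using m by (auto simp: p_def intro!: exI[of _ p])
qed

lemma graph_matrices_mat_of_fun:
  "A \<in> graph_matrices n G \<Omega> \<longleftrightarrow>
    (\<exists>a. A = mat_of_fun n (restr (\<lambda>i j. (i, j) \<in> parcs G) a) \<and>
      (\<forall>i<n. \<forall>j<n. i = j \<or> (i, j) \<in> parcs G \<longrightarrow> a i j \<in> \<Omega>))"
  (is "_ \<longleftrightarrow> (\<exists>a. ?R a)")
proof
  assume A: "A \<in> graph_matrices n G \<Omega>"
  then have entry: "if i = j \<or> (i, j) \<in> parcs G then A $$ (i, j) \<in> \<Omega> else A $$ (i, j) = 0"
    if "i < n" "j < n" for i j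
    using that unfolding graph_matrices_def by blast
  have dim: "dim_row A = n" "dim_col A = n" using A by (auto simp: graph_matrices_def)
  have "A = mat_of_fun n (restr (\<lambda>i j. (i, j) \<in> parcs G) (\<lambda>i j. A $$ (i, j)))"
    by (rule eq_matI) (use entry dim in \<open>simp_all add: restr_def\<close>)
  moreover have "\<forall>i<n. \<forall>j<n. i = j \<or> (i, j) \<in> parcs G \<longrightarrow> A $$ (i, j) \<in> \<Omega>"
    using entry by metis
  ultimately show "\<exists>a. ?R a" by blast
next
  assume "\<exists>a. ?R a"
  then show "A \<in> graph_matrices n G \<Omega>"
    by (auto simp: graph_matrices_def restr_def)
qed

lemma graph_map_mat_of_fun:
  "graph_map n G f (mat_of_fun n (restr (\<lambda>i j. (i, j) \<in> parcs G) a))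
    = mat_of_fun n (restr (\<lambda>i j. (i, j) \<in> parcs G) (\<lambda>i j. f (a i j)))"
  unfolding graph_map_def restr_def by (intro eq_matI) auto

text \<open>On edges f acts by \<alpha> and a unit factor \<kappa> i j, which respects Hermitian
  symmetry because f commutes with conjugation. Acyclicity turns these factors into vertex
  phases.\<close>

lemma gauge_of_moduli:
  fixes \<alpha> :: real
  assumes E: "symp E" and irrefl: "\<And>i. \<not> E i i" and acyclic: "\<And>m c. \<not> cycle_fun E m c"
    and \<alpha>: "0 < \<alpha>" and herm: "herm_on n (restr E a)"
    and in\<Omega>: "\<And>i j. i < n \<Longrightarrow> j < n \<Longrightarrow> i = j \<or> E i j \<Longrightarrow> a i j \<in> \<Omega>"
    and real: "\<And>x. x \<in> \<Omega> \<inter> \<real> \<Longrightarrow> f x = of_real \<alpha> * x"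
    and nonreal: "\<And>z. z \<in> \<Omega> - \<real> \<Longrightarrow> cmod (f z) = \<alpha> * cmod z \<and> f (cnj z) = cnj (f z)"
  obtains \<theta> where "\<And>i. cmod (\<theta> i) = 1"
    "\<And>i j. i < n \<Longrightarrow> j < n \<Longrightarrow>
      restr E (\<lambda>i j. f (a i j)) i j = of_real \<alpha> * (\<theta> i * cnj (\<theta> j)) * restr E a i j"
proof -
  \<comment> \<open>At a zero entry f vanishes too, by the modulus condition; the default 1 keeps
    the factor unimodular there.\<close>
  define \<kappa> where "\<kappa> i j = (if a i j = 0 then 1 else f (a i j) / (of_real \<alpha> * a i j))" for i j
  have norm: "cmod (f z) = \<alpha> * cmod z" if "z \<in> \<Omega>" for z
    using real[of z] nonreal[of z] that \<alpha> by (cases "z \<in> \<real>") (auto simp: norm_mult)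
  have cnj: "f (cnj z) = cnj (f z)" if "z \<in> \<Omega>" for z
    using real[of z] nonreal[of z] that by (cases "z \<in> \<real>") (auto simp: Reals_cnj_iff)
  have f: "f (a i j) = of_real \<alpha> * \<kappa> i j * a i j" if "i < n" "j < n" "i = j \<or> E i j" for i j
    using norm[OF in\<Omega>[OF that]] \<alpha> by (cases "a i j = 0") (simp_all add: \<kappa>_def)
  have unit: "cmod (\<kappa> i j) = 1" if "i < n" "j < n" "i = j \<or> E i j" for i j
    using norm[OF in\<Omega>[OF that]] \<alpha> by (simp add: \<kappa>_def norm_divide norm_mult)
  have sym: "a j i = cnj (a i j)" if "i < n" "j < n" "E i j" for i j
    using herm_onD[OF herm that(1,2)] that(3) sympD[OF E that(3)] by (simp add: restr_def)
  have \<kappa>_herm: "\<kappa> j i = cnj (\<kappa> i j)" if "i < n" "j < n" "E i j" for i j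
    using cnj[OF in\<Omega>[OF that(1,2)]] that(3) unfolding \<kappa>_def sym[OF that] by simp
  have "\<exists>\<theta>. (\<forall>i. cmod (\<theta> i) = 1) \<and> (\<forall>i\<in>{..<n}. \<forall>j\<in>{..<n}. E i j \<longrightarrow> \<kappa> i j = \<theta> i * cnj (\<theta> j))"
    using unit \<kappa>_herm acyclic by (intro forest_gauge[OF _ E irrefl]) auto
  then obtain \<theta> where \<theta>: "\<And>i. cmod (\<theta> i) = 1"
    and \<kappa>: "\<And>i j. i < n \<Longrightarrow> j < n \<Longrightarrow> E i j \<Longrightarrow> \<kappa> i j = \<theta> i * cnj (\<theta> j)" by auto
  show thesis
  proof (rule that[OF \<theta>])
    fix i j assume ij: "i < n" "j < n"
    show "restr E (\<lambda>i j. f (a i j)) i j = of_real \<alpha> * (\<theta> i * cnj (\<theta> j)) * restr E a i j"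
    proof (cases "i = j")
      case True
      have "\<theta> i * cnj (\<theta> i) = 1" using \<theta>[of i] by (simp add: complex_norm_square[symmetric])
      \<comment> \<open>A Hermitian matrix has a real diagonal, on which f is multiplication by
        \<alpha>, in agreement with the trivial phase.\<close>
      moreover have "a i i \<in> \<real>"
        using herm_on_diag[OF herm ij(1)] by (metis Reals_of_real restr_diag)
      ultimately show ?thesis using True real[of "a i i"] in\<Omega>[OF ij(1) ij(1)] by simp
    next
      case False
      then show ?thesis using f[OF ij] \<kappa>[OF ij] by (simp add: restr_def)
    qed
  qed
qed

section \<open>The two equivalences, for both notions of definiteness at once\<close>

theorem theorem4:
  fixes n :: nat and G :: "nat pair_pre_digraph"
    and \<Omega> :: "complex set" and f :: "complex \<Rightarrow> complex"
  assumes "n \<ge> 3"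
    and "pair_graph G" and "pverts G = {0..<n}"
    and "Digraph_Component.connected (with_proj G)"
    and "\<Omega> = \<real> \<or> \<Omega> = UNIV \<or> \<Omega> = complex_of_real ` {0<..}"
  shows "\<forall>P \<in> {positive_definite, positive_semidefinite}.
    (undirected_tree G \<longrightarrow>
      ((\<forall>A \<in> graph_matrices n G \<Omega>. hermitian A \<longrightarrow> (P A \<longleftrightarrow> P (graph_map n G f A))) \<longleftrightarrow>
       (\<exists>\<alpha>::real. \<alpha> > 0 \<and>
          (\<forall>x \<in> \<Omega> \<inter> \<real>. f x = complex_of_real \<alpha> * x) \<and>
          (\<forall>z \<in> \<Omega> - \<real>. cmod (f z) = \<alpha> * cmod z \<and> f (cnj z) = cnj (f z))))) \<and>
    (\<not> undirected_tree G \<longrightarrow>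
      ((\<forall>A \<in> graph_matrices n G \<Omega>. hermitian A \<longrightarrow> (P A \<longleftrightarrow> P (graph_map n G f A))) \<longleftrightarrow>
       (\<exists>\<alpha>::real. \<alpha> > 0 \<and>
          ((\<forall>z \<in> \<Omega>. f z = complex_of_real \<alpha> * z) \<or>
           (\<forall>z \<in> \<Omega>. f z = complex_of_real \<alpha> * cnj z)))))"
proof
  fix P assume P: "P \<in> {positive_definite, positive_semidefinite}"
  define E where "E i j \<longleftrightarrow> (i, j) \<in> parcs G" for i j
  interpret G: pair_graph G by (fact assms(2))
  have E_eq: "(\<lambda>i j. (i, j) \<in> parcs G) = E" by (simp add: E_def fun_eq_iff)
  have E_sym: "symp E"
    using G.pair_sym_arcs unfolding symmetric_def E_def by (auto intro: sympI dest: symD)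
  have irrefl: "\<not> E i i" for i using G.pair_no_loops[of "(i, i)"] by (auto simp: E_def)
  have wf: "pair_wf_digraph G" ..
  have lt: "i < n" "j < n" if "E i j" for i j
    using G.in_arcsD1[of i j] G.in_arcsD2[of i j] that assms(3) by (auto simp: E_def)
  have path: "\<exists>p q r. p < n \<and> q < n \<and> r < n \<and> p \<noteq> q \<and> q \<noteq> r \<and> p \<noteq> r \<and> E p q \<and> E q r"
    using connected_path[OF assms(4) wf assms(3,1)] E_sym unfolding E_eq by (simp add: E_def)
  \<comment> \<open>Connectedness is given, so being a tree reduces to the absence of
    cycles.\<close>
  have tree: "undirected_tree G \<longleftrightarrow> (\<forall>m c. \<not> cycle_fun E m c)"
    unfolding undirected_tree_def has_undirected_cycle_iff[OF wf] E_eq using assms(4) by simp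
  define Q where "Q a \<longleftrightarrow> P (mat_of_fun n a)" for a
  have Q_cases: "Q = pd_on n \<or> Q = psd_on n"
  proof -
    consider "P = positive_definite" | "P = positive_semidefinite" using P by blast
    then show ?thesis
    proof cases
      case 1
      then have "Q a \<longleftrightarrow> pd_on n a" for a unfolding Q_def by (simp only: positive_definite_mat_of_fun)
      then show ?thesis by blast
    next
      case 2
      then have "Q a \<longleftrightarrow> psd_on n a" for a unfolding Q_def by (simp only: positive_semidefinite_mat_of_fun)
      then show ?thesis by blast
    qed
  qed
  have pos_in: "of_real x \<in> \<Omega>" if "0 < x" for x :: real
    using assms(5)
  proof (elim disjE)
    assume "\<Omega> = complex_of_real ` {0<..}"
    then show ?thesis using that by blast
  qed simp_all
  let ?H = "\<forall>A \<in> graph_matrices n G \<Omega>. hermitian A \<longrightarrow> (P A \<longleftrightarrow> P (graph_map n G f A))"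
  have map: "graph_map n G f (mat_of_fun n (restr E a)) = mat_of_fun n (restr E (\<lambda>i j. f (a i j)))" for a
    using graph_map_mat_of_fun[of n G f a] unfolding E_eq .
  \<comment> \<open>Quantification over matrices with prescribed zeros becomes quantification over
    functions \<open>a\<close>, whose values off the edges are erased by
    \<open>restr\<close>.\<close>
  have H_iff: "?H \<longleftrightarrow> (\<forall>a. herm_on n (restr E a) \<longrightarrow>
      (\<forall>i<n. \<forall>j<n. i = j \<or> E i j \<longrightarrow> a i j \<in> \<Omega>) \<longrightarrow>
      (Q (restr E a) \<longleftrightarrow> Q (restr E (\<lambda>i j. f (a i j)))))"
    (is "_ \<longleftrightarrow> ?R")
  proof
    assume H: ?H
    show ?R
    proof (intro allI impI)
      fix a assume herm: "herm_on n (restr E a)"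
        and in\<Omega>: "\<forall>i<n. \<forall>j<n. i = j \<or> E i j \<longrightarrow> a i j \<in> \<Omega>"
      have "mat_of_fun n (restr E a) \<in> graph_matrices n G \<Omega>"
        unfolding graph_matrices_mat_of_fun E_eq E_def[symmetric]
        by (rule exI[of _ a]) (rule conjI[OF refl in\<Omega>])
      with H have "hermitian (mat_of_fun n (restr E a)) \<longrightarrow>
          (P (mat_of_fun n (restr E a)) \<longleftrightarrow> P (graph_map n G f (mat_of_fun n (restr E a))))" by (rule bspec)
      then show "Q (restr E a) \<longleftrightarrow> Q (restr E (\<lambda>i j. f (a i j)))"
        unfolding map Q_def hermitian_mat_of_fun using herm by (rule mp)
    qed
  next
    assume R: ?R
    show ?H
    proof (intro ballI impI)
      fix A assume "A \<in> graph_matrices n G \<Omega>" and herm: "hermitian A"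
      then obtain a where a: "A = mat_of_fun n (restr E a)"
          "\<forall>i<n. \<forall>j<n. i = j \<or> E i j \<longrightarrow> a i j \<in> \<Omega>"
        unfolding graph_matrices_mat_of_fun E_eq E_def[symmetric] by (elim exE conjE)
      have "herm_on n (restr E a)" using herm unfolding a(1) hermitian_mat_of_fun .
      then have "Q (restr E a) \<longleftrightarrow> Q (restr E (\<lambda>i j. f (a i j)))"
        using R[rule_format, of a] a(2) by simp
      then show "P A \<longleftrightarrow> P (graph_map n G f A)" unfolding a(1) map Q_def .
    qed
  qed
  have preserver: "definiteness_preserver n E \<Omega> f Q" if H: ?H
  proof
    show "symp E" by (fact E_sym)
    show "\<exists>p q r. p < n \<and> q < n \<and> r < n \<and> p \<noteq> q \<and> q \<noteq> r \<and> p \<noteq> r \<and> E p q \<and> E q r" by (fact path)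
    show "of_real x \<in> \<Omega>" if "0 < x" for x :: real using pos_in that .
    show "pd_on n a \<Longrightarrow> Q a" "Q a \<Longrightarrow> psd_on n a" for a
      using Q_cases pd_on_imp_psd_on by auto
    show "Q (restr E a) \<longleftrightarrow> Q (restr E (\<lambda>i j. f (a i j)))"
      if "herm_on n a" "\<And>i j. i < n \<Longrightarrow> j < n \<Longrightarrow> i = j \<or> E i j \<Longrightarrow> a i j \<in> \<Omega>" for a
      using H that herm_on_restr[OF that(1) E_sym] unfolding H_iff by blast
  qed
  have transfer: ?H
    if "\<And>a. herm_on n (restr E a) \<Longrightarrow>
        (\<And>i j. i < n \<Longrightarrow> j < n \<Longrightarrow> i = j \<or> E i j \<Longrightarrow> a i j \<in> \<Omega>) \<Longrightarrow>
        (pd_on n (restr E (\<lambda>i j. f (a i j))) \<longleftrightarrow> pd_on n (restr E a)) \<and>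
        (psd_on n (restr E (\<lambda>i j. f (a i j))) \<longleftrightarrow> psd_on n (restr E a))"
    unfolding H_iff using that Q_cases by blast
  have tree_iff: "?H \<longleftrightarrow> (\<exists>\<alpha>::real. \<alpha> > 0 \<and>
          (\<forall>x \<in> \<Omega> \<inter> \<real>. f x = complex_of_real \<alpha> * x) \<and>
          (\<forall>z \<in> \<Omega> - \<real>. cmod (f z) = \<alpha> * cmod z \<and> f (cnj z) = cnj (f z)))"
    if acyclic: "\<And>m c. \<not> cycle_fun E m c"
  proof
    assume ?H
    then interpret definiteness_preserver n E \<Omega> f Q by (rule preserver)
    have "f x = of_real (g 1) * x" if "x \<in> \<Omega> \<inter> \<real>" for x
      using that f_real by (auto elim!: Reals_cases)
    moreover have "cmod (f z) = g 1 * cmod z \<and> f (cnj z) = cnj (f z)" if "z \<in> \<Omega> - \<real>" for z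
    proof -
      \<comment> \<open>A nonreal element exists only in the full plane, so its conjugate is also in
        \<Omega>, as \<open>f_edge\<close> requires.\<close>
      have "\<Omega> = UNIV" using that assms(5) by auto
      then show ?thesis using f_edge[of z] by simp
    qed
    ultimately show "\<exists>\<alpha>::real. \<alpha> > 0 \<and>
          (\<forall>x \<in> \<Omega> \<inter> \<real>. f x = complex_of_real \<alpha> * x) \<and>
          (\<forall>z \<in> \<Omega> - \<real>. cmod (f z) = \<alpha> * cmod z \<and> f (cnj z) = cnj (f z))"
      using g_pos[of 1] by (intro exI[of _ "g 1"]) auto
  next
    assume "\<exists>\<alpha>::real. \<alpha> > 0 \<and>
          (\<forall>x \<in> \<Omega> \<inter> \<real>. f x = complex_of_real \<alpha> * x) \<and>
          (\<forall>z \<in> \<Omega> - \<real>. cmod (f z) = \<alpha> * cmod z \<and> f (cnj z) = cnj (f z))"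
    then obtain \<alpha> :: real where \<alpha>: "0 < \<alpha>"
      and real: "\<And>x. x \<in> \<Omega> \<inter> \<real> \<Longrightarrow> f x = of_real \<alpha> * x"
      and nonreal: "\<And>z. z \<in> \<Omega> - \<real> \<Longrightarrow> cmod (f z) = \<alpha> * cmod z \<and> f (cnj z) = cnj (f z)"
      by blast
    show ?H
    proof (rule transfer)
      fix a assume herm: "herm_on n (restr E a)"
        and in\<Omega>: "\<And>i j. i < n \<Longrightarrow> j < n \<Longrightarrow> i = j \<or> E i j \<Longrightarrow> a i j \<in> \<Omega>"
      obtain \<theta> where \<theta>: "\<And>i. cmod (\<theta> i) = 1"
        "\<And>i j. i < n \<Longrightarrow> j < n \<Longrightarrow>
          restr E (\<lambda>i j. f (a i j)) i j = of_real \<alpha> * (\<theta> i * cnj (\<theta> j)) * restr E a i j"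
        using gauge_of_moduli[OF E_sym irrefl acyclic \<alpha> herm in\<Omega> real nonreal] by metis
      show "(pd_on n (restr E (\<lambda>i j. f (a i j))) \<longleftrightarrow> pd_on n (restr E a)) \<and>
          (psd_on n (restr E (\<lambda>i j. f (a i j))) \<longleftrightarrow> psd_on n (restr E a))"
        by (rule definiteness_gauge[OF herm \<alpha> \<theta>])
    qed
  qed
  have cyclic_iff: "?H \<longleftrightarrow> (\<exists>\<alpha>::real. \<alpha> > 0 \<and>
          ((\<forall>z \<in> \<Omega>. f z = complex_of_real \<alpha> * z) \<or>
           (\<forall>z \<in> \<Omega>. f z = complex_of_real \<alpha> * cnj z)))"
    if cyc: "cycle_fun E m c" for m c
  proof
    assume ?H
    then interpret definiteness_preserver n E \<Omega> f Q by (rule preserver)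
    have "(\<forall>z \<in> \<Omega>. f z = of_real (g 1) * z) \<or> (\<forall>z \<in> \<Omega>. f z = of_real (g 1) * cnj z)"
    proof (cases "\<Omega> = UNIV")
      case True
      have sub: "c ` {..m} \<subseteq> {..<n}"
      proof
        fix p assume "p \<in> c ` {..m}"
        then obtain i where "i \<le> m" "p = c i" by auto
        then show "p \<in> {..<n}"
          using cyc lt[of "c i" "c (Suc i)"] lt[of "c m" "c 0"]
          by (cases "i = m") (auto simp: cycle_fun_def)
      qed
      show ?thesis
        using f_rigid_of_cycle[OF True _ sub] cyc unfolding True by (simp add: cycle_fun_def)
    next
      case False
      \<comment> \<open>When all of \<Omega> is real, the values from \<open>f_real\<close> already
        give the linear alternative.\<close>
      then have "x \<in> \<real>" if "x \<in> \<Omega>" for x using assms(5) that by auto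
      then show ?thesis using f_real by (metis Reals_cases)
    qed
    then show "\<exists>\<alpha>::real. \<alpha> > 0 \<and>
          ((\<forall>z \<in> \<Omega>. f z = complex_of_real \<alpha> * z) \<or>
           (\<forall>z \<in> \<Omega>. f z = complex_of_real \<alpha> * cnj z))"
      using g_pos[of 1] by (intro exI[of _ "g 1"]) auto
  next
    assume "\<exists>\<alpha>::real. \<alpha> > 0 \<and>
          ((\<forall>z \<in> \<Omega>. f z = complex_of_real \<alpha> * z) \<or>
           (\<forall>z \<in> \<Omega>. f z = complex_of_real \<alpha> * cnj z))"
    then obtain \<alpha> :: real where \<alpha>: "0 < \<alpha>"
      and f: "(\<forall>z \<in> \<Omega>. f z = of_real \<alpha> * z) \<or> (\<forall>z \<in> \<Omega>. f z = of_real \<alpha> * cnj z)"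
      by blast
    show ?H
    proof (rule transfer)
      fix a assume herm: "herm_on n (restr E a)"
        and in\<Omega>: "\<And>i j. i < n \<Longrightarrow> j < n \<Longrightarrow> i = j \<or> E i j \<Longrightarrow> a i j \<in> \<Omega>"
      from f show "(pd_on n (restr E (\<lambda>i j. f (a i j))) \<longleftrightarrow> pd_on n (restr E a)) \<and>
          (psd_on n (restr E (\<lambda>i j. f (a i j))) \<longleftrightarrow> psd_on n (restr E a))"
      proof
        assume "\<forall>z \<in> \<Omega>. f z = of_real \<alpha> * z"
        then show ?thesis
          using in\<Omega> by (intro definiteness_gauge[OF herm \<alpha>, of "\<lambda>_. 1"]) (auto simp: restr_def)
      next
        assume "\<forall>z \<in> \<Omega>. f z = of_real \<alpha> * cnj z"
        then show ?thesis
          using in\<Omega> by (intro definiteness_cnj[OF herm \<alpha>]) (auto simp: restr_def)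
      qed
    qed
  qed
  show "(undirected_tree G \<longrightarrow>
      ((\<forall>A \<in> graph_matrices n G \<Omega>. hermitian A \<longrightarrow> (P A \<longleftrightarrow> P (graph_map n G f A))) \<longleftrightarrow>
       (\<exists>\<alpha>::real. \<alpha> > 0 \<and>
          (\<forall>x \<in> \<Omega> \<inter> \<real>. f x = complex_of_real \<alpha> * x) \<and>
          (\<forall>z \<in> \<Omega> - \<real>. cmod (f z) = \<alpha> * cmod z \<and> f (cnj z) = cnj (f z))))) \<and>
    (\<not> undirected_tree G \<longrightarrow>
      ((\<forall>A \<in> graph_matrices n G \<Omega>. hermitian A \<longrightarrow> (P A \<longleftrightarrow> P (graph_map n G f A))) \<longleftrightarrow>
       (\<exists>\<alpha>::real. \<alpha> > 0 \<and>
          ((\<forall>z \<in> \<Omega>. f z = complex_of_real \<alpha> * z) \<or>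
           (\<forall>z \<in> \<Omega>. f z = complex_of_real \<alpha> * cnj z)))))"
    using tree tree_iff cyclic_iff by blast
qed

end
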